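(* Let $\mathcal{V}$ be a locally finite idempotent bounded width variety with terms $f,g$ forming a standard pair (in the sense defined in the context) such that the clone generated by $g$ is minimal among bounded width clones. Then there is a sequence of binary terms $p_0,\dots,p_n\in\operatorname{Clo}(f)$ such that $p_0(x,y)\approx x$, $p_n(x,y)\approx y$, and for each $0\le i<n$ the set $\{p_i(x,y),p_{i+1}(x,y)\}\subseteq\mathcal{F}_{\mathcal{V}}(x,y)$ is closed under $g$.
   Context: $\mathcal{F}_{\mathcal{V}}(x,y)$ is the free algebra in $\mathcal{V}$ on two generators $x,y$. $\operatorname{Clo}(\cdot)$ denotes the clone (of terms of $\mathcal{V}$, modulo the identities of $\mathcal{V}$) generated by the given terms. Bounded width: a locally finite idempotent variety (or a finite idempotent algebra, or a clone of idempotent terms of a locally finite variety) has bounded width if it has terms $g_0$ (ternary) and $h_0$ ($4$-ary) satisfying $$g_0(x,x,y)\approx g_0(x,y,x)\approx g_0(y,x,x)\approx h_0(x,x,x,y)\approx h_0(x,x,y,x)\approx h_0(x,y,x,x)\approx h_0(y,x,x,x).$$ (For finite idempotent algebras this is known to be equivalent to solvability of the constraint satisfaction problem by local consistency checking.) The clone generated by $g$ is minimal if it has bounded width and no proper subclone of $\operatorname{Clo}(g)$ has bounded width. Intersecting families: a family $\mathcal{F}$ of subsets of $\{1,\dots,n\}$ is intersecting if $A\cap B\ne\emptyset$ for all $A,B\in\mathcal{F}$, and maximal if maximal under containment among such families. Standard pair: terms $f$ (binary) and $g$ (ternary), both idempotent, form a standard pair if $g(x,x,y)\approx g(x,y,x)\approx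 g(y,x,x)\approx f(x,y)$, $f(f(x,y),f(y,x))\approx f(x,y)$, $g(g(x,y,z),g(y,z,x),g(z,x,y))\approx g(x,y,z)$, and there is a family of idempotent terms $h_{\mathcal{F}}\in\operatorname{Clo}(g)$, indexed by the maximal intersecting families $\mathcal{F}$ of subsets of $\{1,\dots,n\}$, $n\ge2$, with $h_{\mathcal{F}}$ of arity $n$, such that: $h_{\mathcal{F}}(a_1,\dots,a_n)\approx f(x,y)$ whenever $\{a_1,\dots,a_n\}=\{x,y\}$ and $\{i\mid a_i=x\}\in\mathcal{F}$; $g=h_{\mathcal{M}}$ for $\mathcal{M}=\{\{1,2\},\{1,3\},\{2,3\},\{1,2,3\}\}$; and for any binary term $t$ in the clone generated by the $h_{\mathcal{F}}$ and any distinct $a,b$ in an algebra of $\mathcal{V}$, $t(a,b)=t(b,a)=a$ implies $f(a,b)=f(b,a)=a$. *)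

theory Defs
  imports Main
begin

section \<open>Terms and algebras\<close>

text \<open>
  An \<open>n\<close>-ary term is a term in the variables \<open>Var 1, \<dots>, Var n\<close>, so that argument positions
  agree with the index set \<open>{1..n}\<close>; the variable \<open>Var 0\<close> has no special role.
\<close>

datatype 's trm = Var nat | App 's "'s trm list"

fun vars :: "'s trm \<Rightarrow> nat set" where
  "vars (Var i) = {i}"
| "vars (App F ts) = (\<Union>t\<in>set ts. vars t)"

fun subst :: "(nat \<Rightarrow> 's trm) \<Rightarrow> 's trm \<Rightarrow> 's trm" where
  "subst \<sigma> (Var i) = \<sigma> i"
| "subst \<sigma> (App F ts) = App F (map (subst \<sigma>) ts)"

text \<open>\<open>app t [s\<^sub>1, \<dots>, s\<^sub>n]\<close> is \<open>t(s\<^sub>1, \<dots>, s\<^sub>n)\<close>; it is meaningful only for \<open>n\<close>-ary \<open>t\<close>.\<close>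

definition app :: "'s trm \<Rightarrow> 's trm list \<Rightarrow> 's trm" where
  "app t ss = subst (\<lambda>i. ss ! (i - 1)) t"

record ('s, 'a) alg =
  univ :: "'a set"
  intp :: "'s \<Rightarrow> 'a list \<Rightarrow> 'a"

fun eval :: "('s, 'a) alg \<Rightarrow> (nat \<Rightarrow> 'a) \<Rightarrow> 's trm \<Rightarrow> 'a" where
  "eval A v (Var i) = v i"
| "eval A v (App F ts) = intp A F (map (eval A v) ts)"

text \<open>The term operation of an \<open>n\<close>-ary term, applied to a list of \<open>n\<close> elements.\<close>

definition trm_op :: "('s, 'a) alg \<Rightarrow> 's trm \<Rightarrow> 'a list \<Rightarrow> 'a" where
  "trm_op A t as = eval A (\<lambda>i. as ! (i - 1)) t"

definition closed_under :: "('s, 'a) alg \<Rightarrow> nat \<Rightarrow> 's trm \<Rightarrow> 'a set \<Rightarrow> bool" where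
  "closed_under A n t S \<longleftrightarrow> (\<forall>as. length as = n \<and> set as \<subseteq> S \<longrightarrow> trm_op A t as \<in> S)"

definition holds :: "('s, 'a) alg \<Rightarrow> 's trm \<Rightarrow> 's trm \<Rightarrow> bool" where
  "holds A s t \<longleftrightarrow> (\<forall>v. range v \<subseteq> univ A \<longrightarrow> eval A v s = eval A v t)"


section \<open>Varieties\<close>

text \<open>A variety is given by its signature and a set of defining identities.\<close>

record 's variety =
  arity :: "'s \<Rightarrow> nat"
  idents :: "('s trm \<times> 's trm) set"

fun wf_trm :: "'s variety \<Rightarrow> 's trm \<Rightarrow> bool" where
  "wf_trm V (Var i) \<longleftrightarrow> True"
| "wf_trm V (App F ts) \<longleftrightarrow> length ts = arity V F \<and> (\<forall>t\<in>set ts. wf_trm V t)"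

definition is_variety :: "'s variety \<Rightarrow> bool" where
  "is_variety V \<longleftrightarrow> (\<forall>(s, t)\<in>idents V. wf_trm V s \<and> wf_trm V t)"

definition nary :: "'s variety \<Rightarrow> nat \<Rightarrow> 's trm \<Rightarrow> bool" where
  "nary V n t \<longleftrightarrow> wf_trm V t \<and> vars t \<subseteq> {1..n}"

definition subuniverse :: "'s variety \<Rightarrow> ('s, 'a) alg \<Rightarrow> 'a set \<Rightarrow> bool" where
  "subuniverse V A S \<longleftrightarrow> S \<subseteq> univ A \<and>
     (\<forall>F as. length as = arity V F \<and> set as \<subseteq> S \<longrightarrow> intp A F as \<in> S)"

definition generated :: "'s variety \<Rightarrow> ('s, 'a) alg \<Rightarrow> 'a set \<Rightarrow> 'a set" where
  "generated V A X = \<Inter>{S. subuniverse V A S \<and> X \<subseteq> S}"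

definition in_variety :: "('s, 'a) alg \<Rightarrow> 's variety \<Rightarrow> bool" where
  "in_variety A V \<longleftrightarrow> univ A \<noteq> {} \<and> subuniverse V A (univ A) \<and>
     (\<forall>(s, t)\<in>idents V. holds A s t)"

text \<open>
  Quantification over the algebras of a variety is quantification over those algebras whose
  elements are sets of terms.  Every countably generated algebra of the variety, over any type,
  is isomorphic to one of these, because it is a quotient of the term algebra (lemmas
  \<open>countably_generated_representable\<close> and \<open>veq_holds\<close> below).  Hence validity of identities,
  local finiteness, and statements about two elements of an algebra mean the same as with
  unrestricted algebras.
\<close>

type_synonym 's talg = "('s, 's trm set) alg"

definition veq :: "'s variety \<Rightarrow> 's trm \<Rightarrow> 's trm \<Rightarrow> bool" where
  "veq V s t \<longleftrightarrow> wf_trm V s \<and> wf_trm V t \<and> (\<forall>A :: 's talg. in_variety A V \<longrightarrow> holds A s t)"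

definition locally_finite :: "'s variety \<Rightarrow> bool" where
  "locally_finite V \<longleftrightarrow> (\<forall>(A :: 's talg) X. in_variety A V \<and> finite X \<and> X \<subseteq> univ A \<and>
     generated V A X = univ A \<longrightarrow> finite (univ A))"

definition idempotent_trm :: "'s variety \<Rightarrow> nat \<Rightarrow> 's trm \<Rightarrow> bool" where
  "idempotent_trm V n t \<longleftrightarrow> nary V n t \<and> veq V (app t (replicate n (Var 1))) (Var 1)"

definition idempotent_variety :: "'s variety \<Rightarrow> bool" where
  "idempotent_variety V \<longleftrightarrow> (\<forall>F. veq V (App F (replicate (arity V F) (Var 1))) (Var 1))"

text \<open>
  The free algebra on the generators \<open>free_gen V n 1, \<dots>, free_gen V n n\<close>: \<open>n\<close>-ary terms
  modulo the identities of \<open>V\<close>.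
\<close>

definition trm_class :: "'s variety \<Rightarrow> nat \<Rightarrow> 's trm \<Rightarrow> 's trm set" where
  "trm_class V n t = {s. nary V n s \<and> veq V s t}"

definition free_alg :: "'s variety \<Rightarrow> nat \<Rightarrow> 's talg" where
  "free_alg V n =
     \<lparr>univ = trm_class V n ` {t. nary V n t},
      intp = (\<lambda>F cs. {s. nary V n s \<and> (\<exists>ts. list_all2 (\<in>) ts cs \<and> veq V s (App F ts))})\<rparr>"

definition free_gen :: "'s variety \<Rightarrow> nat \<Rightarrow> nat \<Rightarrow> 's trm set" where
  "free_gen V n i = trm_class V n (Var i)"


section \<open>Clones of terms and bounded width\<close>

text \<open>
  A clone of terms modulo the identities of \<open>V\<close> is represented by the set of all terms
  (in arbitrarily many variables) that represent its elements; its \<open>n\<close>-ary part consists of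
  its \<open>n\<close>-ary terms.
\<close>

definition clone :: "'s variety \<Rightarrow> 's trm set \<Rightarrow> bool" where
  "clone V C \<longleftrightarrow> C \<subseteq> {t. wf_trm V t} \<and> range Var \<subseteq> C \<and>
     (\<forall>t\<in>C. \<forall>\<sigma>. range \<sigma> \<subseteq> C \<longrightarrow> subst \<sigma> t \<in> C) \<and>
     (\<forall>s t. s \<in> C \<and> veq V s t \<longrightarrow> t \<in> C)"

definition Clo :: "'s variety \<Rightarrow> 's trm set \<Rightarrow> 's trm set" where
  "Clo V G = \<Inter>{C. clone V C \<and> G \<subseteq> C}"

definition bounded_width :: "'s variety \<Rightarrow> 's trm set \<Rightarrow> bool" where
  "bounded_width V C \<longleftrightarrow> (\<exists>g\<^sub>0\<in>C. \<exists>h\<^sub>0\<in>C. nary V 3 g\<^sub>0 \<and> nary V 4 h\<^sub>0 \<and>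
     (let x = Var 1; y = Var 2 in
        veq V (app g\<^sub>0 [x, x, y]) (app g\<^sub>0 [x, y, x]) \<and>
        veq V (app g\<^sub>0 [x, y, x]) (app g\<^sub>0 [y, x, x]) \<and>
        veq V (app g\<^sub>0 [y, x, x]) (app h\<^sub>0 [x, x, x, y]) \<and>
        veq V (app h\<^sub>0 [x, x, x, y]) (app h\<^sub>0 [x, x, y, x]) \<and>
        veq V (app h\<^sub>0 [x, x, y, x]) (app h\<^sub>0 [x, y, x, x]) \<and>
        veq V (app h\<^sub>0 [x, y, x, x]) (app h\<^sub>0 [y, x, x, x])))"

definition bounded_width_variety :: "'s variety \<Rightarrow> bool" where
  "bounded_width_variety V \<longleftrightarrow> bounded_width V {t. wf_trm V t}"

definition minimal_bounded_width :: "'s variety \<Rightarrow> 's trm set \<Rightarrow> bool" where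
  "minimal_bounded_width V C \<longleftrightarrow> clone V C \<and> bounded_width V C \<and>
     \<not> (\<exists>D. clone V D \<and> D \<subset> C \<and> bounded_width V D)"


section \<open>Standard pairs\<close>

definition intersecting :: "nat set set \<Rightarrow> bool" where
  "intersecting \<F> \<longleftrightarrow> (\<forall>A\<in>\<F>. \<forall>B\<in>\<F>. A \<inter> B \<noteq> {})"

definition max_intersecting :: "nat \<Rightarrow> nat set set \<Rightarrow> bool" where
  "max_intersecting n \<F> \<longleftrightarrow> \<F> \<subseteq> Pow {1..n} \<and> intersecting \<F> \<and>
     (\<forall>\<G>. \<G> \<subseteq> Pow {1..n} \<and> intersecting \<G> \<and> \<F> \<subseteq> \<G> \<longrightarrow> \<G> = \<F>)"

definition standard_pair :: "'s variety \<Rightarrow> 's trm \<Rightarrow> 's trm \<Rightarrow> bool" where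
  "standard_pair V f g \<longleftrightarrow>
     idempotent_trm V 2 f \<and> idempotent_trm V 3 g \<and>
     (let x = Var 1; y = Var 2; z = Var 3 in
        veq V (app g [x, x, y]) (app f [x, y]) \<and>
        veq V (app g [x, y, x]) (app f [x, y]) \<and>
        veq V (app g [y, x, x]) (app f [x, y]) \<and>
        veq V (app f [app f [x, y], app f [y, x]]) (app f [x, y]) \<and>
        veq V (app g [app g [x, y, z], app g [y, z, x], app g [z, x, y]]) (app g [x, y, z]) \<and>
        (\<exists>h :: nat \<Rightarrow> nat set set \<Rightarrow> 's trm.
           (\<forall>n \<F>. n \<ge> 2 \<and> max_intersecting n \<F> \<longrightarrow>
              h n \<F> \<in> Clo V {g} \<and> idempotent_trm V n (h n \<F>) \<and>
              (\<forall>a. a ` {1..n} = {x, y} \<and> {i\<in>{1..n}. a i = x} \<in> \<F> \<longrightarrow>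
                 veq V (app (h n \<F>) (map a [1..<Suc n])) (app f [x, y]))) \<and>
           veq V g (h 3 {{1, 2}, {1, 3}, {2, 3}, {1, 2, 3}}) \<and>
           (\<forall>t\<in>Clo V {h n \<F> | n \<F>. n \<ge> 2 \<and> max_intersecting n \<F>}. nary V 2 t \<longrightarrow>
              (\<forall>A :: 's talg. in_variety A V \<longrightarrow>
                (\<forall>a\<in>univ A. \<forall>b\<in>univ A. a \<noteq> b \<and> trm_op A t [a, b] = a \<and> trm_op A t [b, a] = a \<longrightarrow>
                   trm_op A f [a, b] = a \<and> trm_op A f [b, a] = a)))))"


section \<open>Adequacy of the universe of sets of terms\<close>

lemma eval_in_subuniverse:
  assumes "subuniverse V A S" "range v \<subseteq> S" "wf_trm V t"
  shows "eval A v t \<in> S"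
  using assms(3)
proof (induction t)
  case (Var i) then show ?case using assms(2) by auto
next
  case (App F ts)
  then have "set (map (eval A v) ts) \<subseteq> S" by auto
  with App.prems assms(1) show ?case
    unfolding subuniverse_def by (metis eval.simps(2) length_map wf_trm.simps(2))
qed

lemma generated_range_eq:
  assumes "subuniverse V A (univ A)" "range v \<subseteq> univ A"
  shows "generated V A (range v) = eval A v ` {t. wf_trm V t}" (is "_ = ?S")
proof
  have "subuniverse V A ?S"
    unfolding subuniverse_def
  proof (intro conjI allI impI)
    show "?S \<subseteq> univ A" using eval_in_subuniverse[OF assms] by auto
    fix F as assume *: "length as = arity V F \<and> set as \<subseteq> ?S"
    then have "\<forall>a\<in>set as. \<exists>t. wf_trm V t \<and> eval A v t = a" by auto
    then obtain r where r: "\<forall>a\<in>set as. wf_trm V (r a) \<and> eval A v (r a) = a" by metis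
    then have "map (eval A v) (map r as) = as" by (simp add: map_idI)
    then have "eval A v (App F (map r as)) = intp A F as" by simp
    moreover have "wf_trm V (App F (map r as))" using r * by simp
    ultimately show "intp A F as \<in> ?S" by (metis image_eqI mem_Collect_eq)
  qed
  moreover have "range v \<subseteq> ?S"
    by (metis (mono_tags, lifting) eval.simps(1) image_iff image_subsetI mem_Collect_eq wf_trm.simps(1))
  ultimately show "generated V A (range v) \<subseteq> ?S" unfolding generated_def by blast
  show "?S \<subseteq> generated V A (range v)"
    unfolding generated_def using eval_in_subuniverse by blast
qed

lemma eval_hom:
  assumes "subuniverse V B (univ B)" "range w \<subseteq> univ B" "wf_trm V t"
    and hom: "\<And>F cs. length cs = arity V F \<Longrightarrow> set cs \<subseteq> univ B \<Longrightarrow>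
      \<phi> (intp B F cs) = intp A F (map \<phi> cs)"
  shows "eval A (\<lambda>i. \<phi> (w i)) t = \<phi> (eval B w t)"
  using assms(3)
proof (induction t)
  case (Var i) then show ?case by simp
next
  case (App F ts)
  have eq: "map (eval A (\<lambda>i. \<phi> (w i))) ts = map \<phi> (map (eval B w) ts)" using App by auto
  have "set (map (eval B w) ts) \<subseteq> univ B"
    using eval_in_subuniverse[OF assms(1,2)] App.prems by auto
  then have "\<phi> (intp B F (map (eval B w) ts)) = intp A F (map \<phi> (map (eval B w) ts))"
    using App.prems by (intro hom) auto
  then show ?case unfolding eval.simps eq by (rule sym)
qed

lemma countably_generated_representable:
  fixes A :: "('s, 'b) alg" and v :: "nat \<Rightarrow> 'b"
  assumes V: "is_variety V" and A: "in_variety A V" and v: "range v \<subseteq> univ A"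
  shows "\<exists>(B :: 's talg) \<phi>. in_variety B V \<and>
    bij_betw \<phi> (univ B) (generated V A (range v)) \<and>
    (\<forall>F cs. length cs = arity V F \<and> set cs \<subseteq> univ B \<longrightarrow>
       \<phi> (intp B F cs) = intp A F (map \<phi> cs))"
proof -
  define S where "S = eval A v ` {t. wf_trm V t}"
  have gen: "generated V A (range v) = S"
    unfolding S_def using A v by (intro generated_range_eq) (auto simp: in_variety_def)
  have S_univ: "S \<subseteq> univ A"
    unfolding S_def using A v eval_in_subuniverse by (fastforce simp: in_variety_def)
  have S: "subuniverse V A S"
    unfolding gen[symmetric] subuniverse_def
  proof (intro conjI allI impI)
    show "generated V A (range v) \<subseteq> univ A" using gen S_univ by simp
    fix F as assume *: "length as = arity V F \<and> set as \<subseteq> generated V A (range v)"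
    show "intp A F as \<in> generated V A (range v)"
      unfolding generated_def
    proof (clarsimp)
      fix T assume T: "subuniverse V A T" "range v \<subseteq> T"
      then have "set as \<subseteq> T" using * unfolding generated_def by blast
      then show "intp A F as \<in> T" using T * unfolding subuniverse_def by blast
    qed
  qed
  define \<psi> where "\<psi> = (\<lambda>a. {t. wf_trm V t \<and> eval A v t = a})"
  have inj: "inj_on \<psi> S"
  proof (rule inj_onI)
    fix a b assume "a \<in> S" "b \<in> S" and eq: "\<psi> a = \<psi> b"
    then obtain t where "t \<in> \<psi> a" "eval A v t = a" unfolding S_def \<psi>_def by auto
    with eq show "a = b" unfolding \<psi>_def by auto
  qed
  define \<phi> where "\<phi> = inv_into S \<psi>"
  define B :: "'s talg" where
    "B = \<lparr>univ = \<psi> ` S, intp = (\<lambda>F cs. \<psi> (intp A F (map \<phi> cs)))\<rparr>"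
  have uB: "univ B = \<psi> ` S" by (simp add: B_def)
  have \<phi>S: "\<phi> c \<in> S" if "c \<in> univ B" for c
    using that unfolding \<phi>_def uB by (rule inv_into_into)
  have \<phi>\<psi>: "\<phi> (\<psi> a) = a" if "a \<in> S" for a
    using that inj by (simp add: \<phi>_def)
  have \<psi>\<phi>: "\<psi> (\<phi> c) = c" if "c \<in> univ B" for c
    using that unfolding \<phi>_def uB by (rule f_inv_into_f)
  have op: "intp A F (map \<phi> cs) \<in> S" if "length cs = arity V F" "set cs \<subseteq> univ B" for F cs
  proof -
    have "set (map \<phi> cs) \<subseteq> S" using that(2) \<phi>S by auto
    then show ?thesis using S that(1) unfolding subuniverse_def by (metis length_map)
  qed
  have hom: "\<phi> (intp B F cs) = intp A F (map \<phi> cs)"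
    if "length cs = arity V F" "set cs \<subseteq> univ B" for F cs
    using op[OF that] \<phi>\<psi> by (simp add: B_def)
  have sB: "subuniverse V B (univ B)"
    unfolding subuniverse_def using op by (auto simp: B_def)
  have ev: "eval A (\<lambda>i. \<phi> (w i)) t = \<phi> (eval B w t)"
    if w: "range w \<subseteq> univ B" and "wf_trm V t" for w :: "nat \<Rightarrow> 's trm set" and t
    using eval_hom[OF sB w that(2) hom] .
  have "holds B s t" if "(s, t) \<in> idents V" for s t
    unfolding holds_def
  proof (intro allI impI)
    fix w :: "nat \<Rightarrow> 's trm set" assume w: "range w \<subseteq> univ B"
    have wf: "wf_trm V s" "wf_trm V t" using V that unfolding is_variety_def by auto
    have "range (\<lambda>i. \<phi> (w i)) \<subseteq> univ A" using w \<phi>S S_univ by blast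
    then have "eval A (\<lambda>i. \<phi> (w i)) s = eval A (\<lambda>i. \<phi> (w i)) t"
      using A that unfolding in_variety_def holds_def by blast
    then have "\<phi> (eval B w s) = \<phi> (eval B w t)" using ev[OF w] wf by simp
    then show "eval B w s = eval B w t"
      using \<psi>\<phi> eval_in_subuniverse[OF sB w] wf by metis
  qed
  moreover have "univ B \<noteq> {}"
    unfolding uB S_def by (auto intro: exI[of _ "Var 0"])
  ultimately have "in_variety B V" unfolding in_variety_def using sB by auto
  moreover have "bij_betw \<phi> (univ B) (generated V A (range v))"
    unfolding gen uB \<phi>_def using inj by (simp add: bij_betw_inv_into inj_on_imp_bij_betw)
  ultimately show ?thesis using hom by blast
qed

corollary veq_holds:
  fixes A :: "('s, 'b) alg"
  assumes V: "is_variety V" and A: "in_variety A V" and "veq V s t"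
  shows "holds A s t"
  unfolding holds_def
proof (intro allI impI)
  fix v :: "nat \<Rightarrow> 'b" assume v: "range v \<subseteq> univ A"
  obtain B :: "'s talg" and \<phi> where B: "in_variety B V"
    and bij: "bij_betw \<phi> (univ B) (generated V A (range v))"
    and hom: "\<forall>F cs. length cs = arity V F \<and> set cs \<subseteq> univ B \<longrightarrow>
       \<phi> (intp B F cs) = intp A F (map \<phi> cs)"
    using countably_generated_representable[OF V A v] by blast
  have sB: "subuniverse V B (univ B)" using B by (simp add: in_variety_def)
  have "v i \<in> \<phi> ` univ B" for i
    using bij_betw_imp_surj_on[OF bij] unfolding generated_def by auto
  then obtain w :: "nat \<Rightarrow> 's trm set" where w: "\<And>i. w i \<in> univ B" "\<And>i. v i = \<phi> (w i)"
    unfolding image_iff by metis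
  then have "range w \<subseteq> univ B" and "v = (\<lambda>i. \<phi> (w i))" by auto
  moreover have "eval B w s = eval B w t"
    using assms(3) B w(1) unfolding veq_def holds_def by blast
  ultimately show "eval A v s = eval A v t"
    using eval_hom[OF sB, of w _ \<phi> A] hom assms(3) unfolding veq_def by simp
qed

end

theory Submission
  imports Defs
begin

text \<open>
  Call \<open>{u, v}\<close> an edge if it is closed under \<open>g\<close>.  We show by induction on the size that every
  finite subset \<open>B\<close> of an algebra of the variety that is closed under \<open>f\<close> is connected by edges
  inside \<open>B\<close>.  Let \<open>\<approx>\<close> be the equivalence generated by the pairs that do not generate \<open>B\<close>
  under \<open>f\<close>; by induction it suffices to refute \<open>u \<not>\<approx> v\<close>.  Otherwise the subalgebra generated
  by \<open>(u, v)\<close> and \<open>(v, u)\<close> behaves modulo \<open>\<approx>\<close> like the graph of an automorphism exchanging \<open>u\<close>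
  and \<open>v\<close>, since a large subalgebra would contain \<open>(u, u)\<close> or \<open>(v, v)\<close>.  As \<open>f(u, v) \<approx> f(v, u)\<close>,
  it follows that \<open>f(u, v)\<close> is equivalent neither to \<open>u\<close> nor to \<open>v\<close>.

  Consider the binary terms \<open>w\<close> that can take the place of \<open>f\<close> in majority-like terms of arities
  3 and 4.  They are closed under \<open>f\<close> and include \<open>f\<close> and \<open>f(f(x, y), f(f(x, y), x))\<close>, whose values
  at \<open>(u, v)\<close> are inequivalent, so their values at \<open>(u, v)\<close> fill \<open>B\<close>.  Hence some such \<open>w\<close> acts as the first projection on
  \<open>{u, v'}\<close> for a \<open>v' \<approx> v\<close>.  The terms in the clone of \<open>g\<close> preserving \<open>{u, v'}\<close> then have bounded
  width, and minimality turns \<open>{u, v'}\<close> into an edge, a contradiction.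
\<close>


section \<open>Connectivity of finite groupoids\<close>

inductive_set gen :: "('a \<Rightarrow> 'a \<Rightarrow> 'a) \<Rightarrow> 'a set \<Rightarrow> 'a set"
  for F :: "'a \<Rightarrow> 'a \<Rightarrow> 'a" and X :: "'a set" where
  base: "x \<in> X \<Longrightarrow> x \<in> gen F X"
| step: "x \<in> gen F X \<Longrightarrow> y \<in> gen F X \<Longrightarrow> F x y \<in> gen F X"

definition closed :: "('a \<Rightarrow> 'a \<Rightarrow> 'a) \<Rightarrow> 'a set \<Rightarrow> bool" where
  "closed F S \<longleftrightarrow> (\<forall>x\<in>S. \<forall>y\<in>S. F x y \<in> S)"

fun pair_op :: "('a \<Rightarrow> 'a \<Rightarrow> 'a) \<Rightarrow> 'a \<times> 'a \<Rightarrow> 'a \<times> 'a \<Rightarrow> 'a \<times> 'a" where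
  "pair_op F (a, b) (c, d) = (F a c, F b d)"

lemma closed_gen: "closed F (gen F X)"
  unfolding closed_def by (blast intro: gen.step)

lemma gen_least:
  assumes "closed F S" "X \<subseteq> S"
  shows "gen F X \<subseteq> S"
proof
  fix x assume "x \<in> gen F X"
  then show "x \<in> S"
    by induction (use assms in \<open>auto simp: closed_def\<close>)
qed

text \<open>
  If \<open>F\<close> takes midpoints in an affine space of odd order, then the rules other than \<open>twist\<close>
  produce nothing but \<open>F\<close>; only \<open>twist\<close> distinguishes \<open>x\<close> from \<open>y\<close>.
\<close>

inductive derived :: "('a \<Rightarrow> 'a \<Rightarrow> 'a) \<Rightarrow> ('a \<Rightarrow> 'a \<Rightarrow> 'a) \<Rightarrow> bool"
  for F :: "'a \<Rightarrow> 'a \<Rightarrow> 'a" where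
  base: "derived F F"
| join: "derived F w \<Longrightarrow> derived F w' \<Longrightarrow> derived F (\<lambda>x y. F (w x y) (w' x y))"
| twist: "derived F (\<lambda>x y. F (F x y) (F (F x y) x))"
| comp: "derived F w \<Longrightarrow> derived F w' \<Longrightarrow> derived F (\<lambda>x y. w' (w x y) (w y x))"

text \<open>\<open>join\<close> and \<open>twist\<close> apply \<open>F\<close> coordinatewise. For
  \<open>comp\<close>, the pair produced by \<open>w\<close> and its reversal lie in the subalgebra
  of the square, so everything they generate does too.\<close>

lemma derived_in_gen:
  assumes "derived F w"
  shows "(w x y, w y x) \<in> gen (pair_op F) {(x, y), (y, x)}"
  using assms
proof (induction arbitrary: x y)
  case base
  show ?case
    using gen.step[of "(x, y)" "pair_op F" "{(x, y), (y, x)}" "(y, x)"]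
    by (simp add: gen.base)
next
  case (join w w')
  show ?case
    using gen.step[OF join.IH(1)[of x y] join.IH(2)[of x y]] by simp
next
  case twist
  let ?G = "gen (pair_op F) {(x, y), (y, x)}"
  have 1: "(x, y) \<in> ?G" "(y, x) \<in> ?G" by (auto intro: gen.base)
  have 2: "(F x y, F y x) \<in> ?G" using gen.step[OF 1] by simp
  have 3: "(F (F x y) x, F (F y x) y) \<in> ?G"
    using gen.step[OF 2 1(1)] by simp
  show ?case using gen.step[OF 2 3] by simp
next
  case (comp w w')
  have "gen (pair_op F) {(w x y, w y x), (w y x, w x y)} \<subseteq> gen (pair_op F) {(x, y), (y, x)}"
    using comp.IH(1)[of x y] comp.IH(1)[of y x]
    by (intro gen_least closed_gen) (simp add: insert_commute)
  then show ?case using comp.IH(2)[of "w x y" "w y x"] by blast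
qed

text \<open>To be instantiated with the operation of \<open>f\<close> for \<open>F\<close> and
  closure of \<open>{x, y}\<close> under \<open>g\<close> for \<open>E x y\<close>. Then
  \<open>E_derived\<close> carries the minimality of the clone, and \<open>E_semilattice\<close> the
  last clause in the definition of a standard pair.\<close>

locale edge_groupoid =
  fixes B :: "'a set" and F :: "'a \<Rightarrow> 'a \<Rightarrow> 'a" and E :: "'a \<Rightarrow> 'a \<Rightarrow> bool"
  assumes finite_B: "finite B"
    and closed_B: "closed F B"
    and idem: "x \<in> B \<Longrightarrow> F x x = x"
    and E_sym: "E x y \<Longrightarrow> E y x"
    and E_closed: "x \<in> B \<Longrightarrow> y \<in> B \<Longrightarrow> E x y \<Longrightarrow> F x y \<in> {x, y}"
    and E_op: "x \<in> B \<Longrightarrow> y \<in> B \<Longrightarrow> E (F x y) (F y x)"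
    and E_derived: "derived F w \<Longrightarrow> x \<in> B \<Longrightarrow> y \<in> B \<Longrightarrow> w x y = x \<Longrightarrow> w y x = y \<Longrightarrow> E x y"
    and E_semilattice: "x \<in> B \<Longrightarrow> y \<in> B \<Longrightarrow> (y, y) \<in> gen (pair_op F) {(x, y), (y, x)} \<Longrightarrow> E x y"
begin

definition basic :: "('a \<times> 'a) set" where
  "basic = {(x, y). x \<in> B \<and> y \<in> B \<and> gen F {x, y} \<noteq> B}"

abbreviation near :: "'a \<Rightarrow> 'a \<Rightarrow> bool" (infix "\<approx>" 50) where
  "x \<approx> y \<equiv> (x, y) \<in> basic\<^sup>*"

lemma near_sym: "x \<approx> y \<Longrightarrow> y \<approx> x"
proof -
  have "sym basic" unfolding sym_def basic_def by (auto simp: insert_commute)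
  then show "x \<approx> y \<Longrightarrow> y \<approx> x" using sym_rtrancl symD by metis
qed

lemma near_trans: "x \<approx> y \<Longrightarrow> y \<approx> z \<Longrightarrow> x \<approx> z"
  by (rule rtrancl_trans)

lemma near_if_proper:
  assumes "closed F S" "S \<subset> B" "x \<in> S" "y \<in> S"
  shows "x \<approx> y"
proof -
  have "gen F {x, y} \<subseteq> S" using assms by (intro gen_least) auto
  then have "(x, y) \<in> basic" using assms unfolding basic_def by auto
  then show ?thesis by blast
qed

text \<open>Elements that are not \<open>near\<close> form no basic pair and so generate
  \<open>B\<close>. Below, a closed set is shown to be everything by finding two such elements in
  it.\<close>

lemma far_generates:
  assumes "closed F S" "x \<in> S" "y \<in> S" "x \<in> B" "y \<in> B" "\<not> x \<approx> y"
  shows "B \<subseteq> S"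
proof -
  have "gen F {x, y} = B" using assms unfolding basic_def by blast
  moreover have "gen F {x, y} \<subseteq> S" using assms by (intro gen_least) auto
  ultimately show ?thesis by simp
qed

lemma op_in: "x \<in> B \<Longrightarrow> y \<in> B \<Longrightarrow> F x y \<in> B"
  using closed_B unfolding closed_def by blast

lemma derived_in: "derived F w \<Longrightarrow> x \<in> B \<Longrightarrow> y \<in> B \<Longrightarrow> w x y \<in> B"
  by (induction arbitrary: x y rule: derived.induct) (auto intro: op_in)

end

section \<open>The swap relation when no edge leaves a class\<close>

locale disconnected = edge_groupoid +
  assumes E_near: "x \<in> B \<Longrightarrow> y \<in> B \<Longrightarrow> E x y \<Longrightarrow> x \<approx> y"
begin

text \<open>As a subalgebra of the square this consists of the pairs
  \<open>(t(u, v), t(v, u))\<close> for binary terms \<open>t\<close> in \<open>F\<close>.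
  "Partners" below are elements related by it.\<close>

abbreviation swap :: "'a \<Rightarrow> 'a \<Rightarrow> ('a \<times> 'a) set" where
  "swap u v \<equiv> gen (pair_op F) {(u, v), (v, u)}"

lemma swap_sym:
  assumes "(x, y) \<in> swap u v"
  shows "(y, x) \<in> swap u v"
proof -
  have "p \<in> swap u v \<Longrightarrow> prod.swap p \<in> swap u v" for p
  proof (induction rule: gen.induct)
    case (base p)
    then show ?case by (auto intro: gen.base)
  next
    case (step p q)
    obtain a b where p: "p = (a, b)" by (rule prod.exhaust)
    obtain c d where q: "q = (c, d)" by (rule prod.exhaust)
    show ?case
      using gen.step[OF step.IH] unfolding p q by simp
  qed
  from this[OF assms] show ?thesis by simp
qed

lemma swap_in:
  assumes "u \<in> B" "v \<in> B"
  shows "swap u v \<subseteq> B \<times> B"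
  using assms by (intro gen_least) (auto simp: closed_def op_in)

text \<open>Taken below for \<open>B\<close> itself, for singletons, which are closed by
  idempotence, and for proper subalgebras.\<close>

lemma swap_image_closed:
  assumes "closed F S" "u \<in> B" "v \<in> B"
  shows "closed F (swap u v `` S)"
  unfolding closed_def
proof (intro ballI)
  fix y y' assume "y \<in> swap u v `` S" "y' \<in> swap u v `` S"
  then obtain x x' where "x \<in> S" "(x, y) \<in> swap u v" "x' \<in> S" "(x', y') \<in> swap u v" by blast
  moreover from this have "F x x' \<in> S" using assms(1) unfolding closed_def by blast
  moreover have "(F x x', F y y') \<in> swap u v"
    using gen.step[of "(x, y)" "pair_op F" _ "(x', y')"] calculation by simp
  ultimately show "F y y' \<in> swap u v `` S" by blast
qed

lemma closed_singleton: "x \<in> B \<Longrightarrow> closed F {x}"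
  by (simp add: closed_def idem)

text \<open>The image of \<open>B\<close> is closed and contains the far elements \<open>u\<close>
  and \<open>v\<close>. With \<open>swap_sym\<close>, every element of \<open>B\<close> has a
  partner.\<close>

lemma swap_total:
  assumes "u \<in> B" "v \<in> B" "\<not> u \<approx> v"
  shows "B \<subseteq> swap u v `` B"
proof (rule far_generates[OF swap_image_closed[OF closed_B assms(1,2)] _ _ assms])
  show "u \<in> swap u v `` B" "v \<in> swap u v `` B" using assms by (auto intro: gen.base)
qed

text \<open>
  Otherwise \<open>x\<close> would be related to everything, which would put \<open>(u, u)\<close> or \<open>(v, v)\<close> into the
  relation and so make \<open>{u, v}\<close> a semilattice.
\<close>

lemma swap_near:
  assumes uv: "u \<in> B" "v \<in> B" "\<not> u \<approx> v" and "(x, y) \<in> swap u v" "(x, y') \<in> swap u v"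
  shows "y \<approx> y'"
proof (rule ccontr)
  assume far: "\<not> y \<approx> y'"
  have B: "x \<in> B" "y \<in> B" "y' \<in> B" using assms swap_in[OF uv(1,2)] by auto
  have nb: "closed F (swap u v `` {z})" if "z \<in> B" for z
    using swap_image_closed[OF closed_singleton[OF that] uv(1,2)] .
  \<comment> \<open>The partners of \<open>x\<close> form a closed set containing the far elements
    \<open>y\<close> and \<open>y'\<close>.\<close>
  have centre: "B \<subseteq> swap u v `` {x}"
    by (rule far_generates[OF nb[OF B(1)] _ _ B(2,3) far]) (use assms in auto)
  \<comment> \<open>Since \<open>x\<close> and \<open>p\<close> are far partners of
    \<open>q\<close>, everything is a partner of \<open>q\<close>, including \<open>q\<close>
    itself; then \<open>{p, q}\<close> would be an edge between far elements. This is applied with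
    \<open>p\<close> the one of \<open>u\<close>, \<open>v\<close> that is far from
    \<open>x\<close>.\<close>
  have diag: False
    if pq: "p \<in> B" "q \<in> B" "(p, q) \<in> swap u v" "\<not> x \<approx> p"
      and E: "(q, q) \<in> swap u v \<Longrightarrow> E p q" and pq_far: "\<not> p \<approx> q" for p q
  proof -
    have "(q, x) \<in> swap u v" using centre pq swap_sym by blast
    moreover have "(q, p) \<in> swap u v" using pq swap_sym by blast
    ultimately have "B \<subseteq> swap u v `` {q}"
      using far_generates[OF nb[OF pq(2)], of x p] pq B by auto
    then show False using pq E pq_far E_near by blast
  qed
  have base: "(u, v) \<in> swap u v" "(v, u) \<in> swap u v" by (auto intro: gen.base)
  show False
  proof (cases "x \<approx> u")
    case False
    then show False using diag[of u v] uv base E_semilattice by blast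
  next
    case True
    then have "\<not> x \<approx> v" using uv(3) near_sym near_trans by metis
    moreover have "(u, u) \<in> swap u v \<Longrightarrow> E v u"
      using E_semilattice[of v u] uv by (simp add: insert_commute)
    ultimately show False using diag[of v u] uv base near_sym by blast
  qed
qed

text \<open>Induction along a chain of basic pairs. Such a pair lies in a proper subalgebra
  \<open>D\<close>; the partners of elements of \<open>D\<close> again form a proper subalgebra,
  hence lie in one class.\<close>

lemma swap_respects_near:
  assumes uv: "u \<in> B" "v \<in> B" "\<not> u \<approx> v" and "x \<approx> x'"
    and "(x, y) \<in> swap u v" "(x', y') \<in> swap u v"
  shows "y \<approx> y'"
  using assms(4,6)
proof (induction arbitrary: y' rule: rtrancl_induct)
  case base
  then show ?case using swap_near[OF uv] assms(5) by blast
next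
  case (step z z')
  then have z: "z \<in> B" "z' \<in> B" and proper: "gen F {z, z'} \<noteq> B" unfolding basic_def by auto
  obtain t where t: "(z, t) \<in> swap u v"
    using swap_total[OF uv] z swap_sym by blast
  define D where "D = gen F {z, z'}"
  have D: "closed F D" "D \<subset> B"
    unfolding D_def using closed_gen gen_least[OF closed_B, of "{z, z'}"] z proper by auto
  have zD: "z \<in> D" "z' \<in> D" unfolding D_def by (auto intro: gen.base)
  \<comment> \<open>If the image of \<open>D\<close> were all of \<open>B\<close>, each
    \<open>s\<close> would share a partner with some element of \<open>D\<close>, and so be near it
    by \<open>swap_near\<close>; then all of \<open>B\<close> would be near
    \<open>z\<close>.\<close>
  have "\<not> B \<subseteq> swap u v `` D"
  proof
    assume onto: "B \<subseteq> swap u v `` D"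
    have "s \<approx> z" if s: "s \<in> B" for s
    proof -
      obtain r where r: "(s, r) \<in> swap u v" using swap_total[OF uv] s swap_sym by blast
      then have "r \<in> B" using swap_in[OF uv(1,2)] by blast
      then obtain d where d: "d \<in> D" "(d, r) \<in> swap u v" using onto by blast
      then have "s \<approx> d" using swap_near[OF uv] r swap_sym by blast
      then show ?thesis using near_if_proper[OF D d(1) zD(1)] near_trans by blast
    qed
    then show False using uv near_sym near_trans by metis
  qed
  moreover have "swap u v `` D \<subseteq> B" using swap_in[OF uv(1,2)] by blast
  ultimately have "t \<approx> y'"
    using near_if_proper[OF swap_image_closed[OF D(1) uv(1,2)], of t y'] t step.prems zD by blast
  then show ?case using step.IH[OF t] near_trans by blast
qed

text \<open>The partner \<open>F v u\<close> of \<open>F u v\<close> is near it, because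
  \<open>E_op\<close> makes the two an edge. If \<open>F u v\<close> were near \<open>u\<close>,
  then their partners \<open>F v u\<close> and \<open>v\<close> would be near, and hence so would
  \<open>u\<close> and \<open>v\<close>. The second claim uses the partner \<open>u\<close> of
  \<open>v\<close> in the same way.\<close>

lemma op_far:
  assumes "u \<in> B" "v \<in> B" "\<not> u \<approx> v"
  shows "\<not> F u v \<approx> u" "\<not> F u v \<approx> v"
proof -
  have m: "(F u v, F v u) \<in> swap u v" using derived_in_gen[OF derived.base] .
  have b: "(u, v) \<in> swap u v" "(v, u) \<in> swap u v" by (auto intro: gen.base)
  have n: "F u v \<approx> F v u" using assms by (intro E_near E_op op_in)
  show "\<not> F u v \<approx> u"
    using swap_respects_near[OF assms _ m b(1)] n assms(3) near_sym near_trans by metis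
  show "\<not> F u v \<approx> v"
    using swap_respects_near[OF assms _ m b(2)] n assms(3) near_sym near_trans by metis
qed

text \<open>The values of derived operations at \<open>(u, v)\<close> form a closed set, so two far
  values suffice to make \<open>u\<close> one of them. Once \<open>w u v = u\<close>, both
  \<open>w v u\<close> and \<open>v\<close> are partners of \<open>u\<close>.\<close>

lemma derived_projection:
  assumes "u \<in> B" "v \<in> B" "\<not> u \<approx> v"
  obtains w where "derived F w" "w u v = u" "w v u \<approx> v"
proof -
  define \<Sigma> where "\<Sigma> = {w u v | w. derived F w}"
  define c where "c = F u v"
  have c: "c \<in> B" "\<not> c \<approx> u" using assms op_in op_far unfolding c_def by auto
  \<comment> \<open>\<open>op_far\<close> for \<open>c\<close> and \<open>u\<close> puts
    \<open>F c u\<close> far from \<open>c\<close>; applied once more, it puts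
    \<open>F c (F c u)\<close> far from \<open>c\<close>. The latter is the value of
    \<open>twist\<close>.\<close>
  then have k: "F c u \<in> B" "\<not> c \<approx> F c u" using assms op_in op_far near_sym by metis+
  then have "\<not> c \<approx> F c (F c u)" using c op_far near_sym by metis
  moreover have "closed F \<Sigma>" unfolding closed_def \<Sigma>_def by (auto intro: derived.join)
  moreover have "c \<in> \<Sigma>" "F c (F c u) \<in> \<Sigma>"
    unfolding \<Sigma>_def c_def using derived.base derived.twist by fastforce+
  ultimately have "B \<subseteq> \<Sigma>" using far_generates c k op_in by metis
  then obtain w where w: "derived F w" "w u v = u" using assms unfolding \<Sigma>_def by fastforce
  have "(u, w v u) \<in> swap u v" using derived_in_gen[OF w(1), of u v] w(2) by simp
  moreover have "(u, v) \<in> swap u v" by (simp add: gen.base)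
  ultimately have "w v u \<approx> v" by (rule swap_near[OF assms])
  then show ?thesis using that w by blast
qed

text \<open>Passing from \<open>v\<close> to \<open>w v u\<close> has to run into a cycle, on which \<open>w\<close> is the first projection.\<close>

lemma all_near:
  assumes "u \<in> B" "v \<in> B"
  shows "u \<approx> v"
proof (rule ccontr)
  assume far: "\<not> u \<approx> v"
  define X where "X = {x \<in> B. \<not> u \<approx> x}"
  \<comment> \<open>By \<open>comp\<close>, \<open>y\<close> in \<open>succ x\<close> implies that
    \<open>succ y\<close> is contained in \<open>succ x\<close>. If \<open>succ x\<close> has least
    cardinality, the two sets agree, and \<open>y\<close> is its own successor.\<close>
  define succ where "succ x = {y \<in> X. \<exists>w. derived F w \<and> w u x = u \<and> w x u = y}" for x
  have fin: "finite (succ x)" for x unfolding succ_def X_def using finite_B by simp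
  have ex: "succ x \<noteq> {}" if x: "x \<in> X" for x
  proof -
    have *: "x \<in> B" "\<not> u \<approx> x" using x unfolding X_def by auto
    obtain w where w: "derived F w" "w u x = u" "w x u \<approx> x"
      using derived_projection[OF assms(1) *] .
    then have "w x u \<in> succ x"
      using * assms derived_in near_trans unfolding succ_def X_def by blast
    then show ?thesis by blast
  qed
  have mono: "succ y \<subseteq> succ x" if "y \<in> succ x" for x y
  proof
    fix z assume "z \<in> succ y"
    then obtain w' where w': "derived F w'" "w' u y = u" "w' y u = z" "z \<in> X"
      unfolding succ_def by blast
    obtain w where w: "derived F w" "w u x = u" "w x u = y" using \<open>y \<in> succ x\<close>
      unfolding succ_def by blast
    show "z \<in> succ x"
      unfolding succ_def using derived.comp[OF w(1) w'(1)] w w' by auto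
  qed
  have "v \<in> X" using assms far unfolding X_def by blast
  then obtain x where x: "x \<in> X" and least: "\<And>y. y \<in> X \<Longrightarrow> card (succ x) \<le> card (succ y)"
    using ex_has_least_nat[of "\<lambda>x. x \<in> X" v "\<lambda>x. card (succ x)"] by blast
  obtain y where y: "y \<in> succ x" using ex[OF x] by blast
  then have "y \<in> X" unfolding succ_def by blast
  then have "succ y = succ x"
    using mono[OF y] least fin card_seteq by blast
  then have "y \<in> succ y" using y by simp
  then obtain w where "derived F w" "w u y = u" "w y u = y" unfolding succ_def by blast
  then show False using E_derived E_near \<open>y \<in> X\<close> assms unfolding X_def by blast
qed

end

section \<open>Connectedness of every finite groupoid with edges\<close>

lemma edge_groupoid_subset:
  assumes "edge_groupoid B F E" "closed F S" "S \<subseteq> B"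
  shows "edge_groupoid S F E"
proof -
  interpret edge_groupoid B F E by fact
  show ?thesis
    by unfold_locales
      (use assms finite_B idem E_sym E_closed E_op E_derived E_semilattice in
        \<open>auto intro: finite_subset simp: subset_iff\<close>)
qed

theorem edge_groupoid_connected:
  assumes "edge_groupoid B F E" "a \<in> B" "b \<in> B"
  shows "(a, b) \<in> {(x, y). x \<in> B \<and> y \<in> B \<and> E x y}\<^sup>*"
  using assms
proof (induction "card B" arbitrary: B a b rule: less_induct)
  case less
  interpret edge_groupoid B F E by fact
  let ?EB = "{(x, y). x \<in> B \<and> y \<in> B \<and> E x y}"
  \<comment> \<open>A basic pair generates a proper subalgebra, which is connected by the induction
    hypothesis.\<close>
  have "basic \<subseteq> ?EB\<^sup>*"
  proof clarify
    fix x y assume xy: "(x, y) \<in> basic"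
    define S where "S = gen F {x, y}"
    have S: "closed F S" "S \<subset> B"
      unfolding S_def using closed_gen gen_least[OF closed_B, of "{x, y}"] xy
      by (auto simp: basic_def)
    then have "(x, y) \<in> {(x, y). x \<in> S \<and> y \<in> S \<and> E x y}\<^sup>*"
      using less.hyps[of S x y] psubset_card_mono[OF finite_B] less.prems(1)
        edge_groupoid_subset[of B F E S] by (auto simp: S_def intro: gen.base)
    moreover have "{(x, y). x \<in> S \<and> y \<in> S \<and> E x y} \<subseteq> ?EB" using S by auto
    ultimately show "(x, y) \<in> ?EB\<^sup>*" using rtrancl_mono by blast
  qed
  then have near: "(x, y) \<in> basic\<^sup>* \<Longrightarrow> (x, y) \<in> ?EB\<^sup>*" for x y
    using rtrancl_subset_rtrancl by blast
  \<comment> \<open>Either all edges stay within classes, and \<open>all_near\<close> leaves a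
    single class; or some edge joins far elements \<open>u\<close> and \<open>v\<close>, and since
    \<open>{u, v}\<close> is closed under \<open>F\<close> it contains \<open>B\<close>.\<close>
  show ?case
  proof (cases "\<forall>x\<in>B. \<forall>y\<in>B. E x y \<longrightarrow> (x, y) \<in> basic\<^sup>*")
    case True
    then interpret disconnected B F E by unfold_locales blast
    show ?thesis using near all_near less.prems by blast
  next
    case False
    then obtain u v where uv: "u \<in> B" "v \<in> B" "E u v" "(u, v) \<notin> basic\<^sup>*" by blast
    have "closed F {u, v}"
      unfolding closed_def using uv E_closed[of u v] E_closed[of v u] E_sym idem by auto
    then have "B \<subseteq> {u, v}" using far_generates uv by blast
    then have "a = b \<or> (a, b) \<in> ?EB" using less.prems uv E_sym by auto
    then show ?thesis by blast
  qed
qed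


section \<open>Terms and clones\<close>

lemma eval_cong: "(\<And>i. i \<in> vars t \<Longrightarrow> v i = w i) \<Longrightarrow> eval A v t = eval A w t"
proof (induction t)
  case (App F ts)
  then have "map (eval A v) ts = map (eval A w) ts" by auto
  then show ?case unfolding eval.simps by (rule arg_cong)
qed simp

lemma subst_cong: "(\<And>i. i \<in> vars t \<Longrightarrow> \<sigma> i = \<tau> i) \<Longrightarrow> subst \<sigma> t = subst \<tau> t"
  by (induction t) auto

lemma subst_Var: "subst Var t = t"
  by (induction t) (auto simp: map_idI)

lemma eval_subst: "eval A v (subst \<sigma> t) = eval A (\<lambda>i. eval A v (\<sigma> i)) t"
proof (induction t)
  case (App F ts)
  then have "map (eval A v) (map (subst \<sigma>) ts) = map (eval A (\<lambda>i. eval A v (\<sigma> i))) ts" by auto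
  then show ?case unfolding eval.simps subst.simps by (rule arg_cong)
qed simp

lemma vars_subst: "vars (subst \<sigma> t) = (\<Union>i\<in>vars t. vars (\<sigma> i))"
  by (induction t) auto

lemma wf_subst:
  "wf_trm V t \<Longrightarrow> (\<And>i. i \<in> vars t \<Longrightarrow> wf_trm V (\<sigma> i)) \<Longrightarrow> wf_trm V (subst \<sigma> t)"
  by (induction t) auto

lemma nary_app:
  assumes "nary V n t" "length ss = n" "\<forall>s\<in>set ss. nary V m s"
  shows "nary V m (app t ss)"
proof -
  have "nary V m (ss ! (i - 1))" if "i \<in> vars t" for i
  proof -
    have "i - 1 < length ss" using that assms(1,2) unfolding nary_def by fastforce
    then show ?thesis using assms(3) nth_mem by blast
  qed
  then show ?thesis
    using assms(1) unfolding nary_def app_def vars_subst by (blast intro: wf_subst)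
qed

lemma eval_app:
  assumes "nary V n t" "length ss = n"
  shows "eval A v (app t ss) = trm_op A t (map (eval A v) ss)"
  unfolding app_def eval_subst trm_op_def
proof (rule eval_cong)
  fix i assume "i \<in> vars t"
  then have "i - 1 < length ss" using assms unfolding nary_def by fastforce
  then show "eval A v (ss ! (i - 1)) = map (eval A v) ss ! (i - 1)" by simp
qed

lemma trm_op_app:
  assumes "nary V n t" "length ss = n"
  shows "trm_op A (app t ss) as = trm_op A t (map (\<lambda>s. trm_op A s as) ss)"
  using eval_app[OF assms, of A "\<lambda>i. as ! (i - 1)"] unfolding trm_op_def .

lemma app_Var:
  assumes "nary V 2 t"
  shows "app t [Var 1, Var 2] = t"
proof -
  have "subst (\<lambda>i. [Var 1, Var 2] ! (i - 1)) t = subst Var t"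
  proof (rule subst_cong)
    fix i assume "i \<in> vars t"
    then have "i = 1 \<or> i = 2" using assms unfolding nary_def by fastforce
    then show "[Var 1, Var 2] ! (i - 1) = Var i" by auto
  qed
  then show ?thesis unfolding app_def subst_Var .
qed

lemma trm_op_Var: "trm_op A (Var i) as = as ! (i - 1)"
  by (simp add: trm_op_def)

lemma nary_Var: "1 \<le> i \<Longrightarrow> i \<le> n \<Longrightarrow> nary V n (Var i)"
  by (simp add: nary_def)

text \<open>One valuation serves all \<open>n\<close>-ary terms. Indices outside
  \<open>1, ..., n\<close> receive the default \<open>a\<close>, since validity of identities is
  tested on valuations whose whole range lies in the algebra.\<close>

lemma trm_op_valuation:
  assumes "length as = n" "a \<in> U" "set as \<subseteq> U"
  shows "\<exists>v. range v \<subseteq> U \<and> (\<forall>t. nary V n t \<longrightarrow> trm_op A t as = eval A v t)"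
proof (intro exI conjI allI impI)
  let ?v = "\<lambda>i. if i \<in> {1..n} then as ! (i - 1) else a"
  show "range ?v \<subseteq> U"
  proof clarify
    fix i
    have "as ! (i - 1) \<in> set as" if "i \<in> {1..n}" using that assms(1) by (intro nth_mem) auto
    then show "?v i \<in> U" using assms by auto
  qed
  show "trm_op A t as = eval A ?v t" if "nary V n t" for t
    unfolding trm_op_def by (rule eval_cong) (use that in \<open>auto simp: nary_def\<close>)
qed

lemma eval_eq_trm_op:
  assumes "nary V n t"
  shows "eval A v t = trm_op A t (map v [1..<Suc n])"
  unfolding trm_op_def
proof (rule eval_cong)
  fix i assume "i \<in> vars t"
  then have "i \<in> {1..n}" using assms unfolding nary_def by blast
  then show "v i = map v [1..<Suc n] ! (i - 1)" by (auto simp del: upt_Suc)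
qed

lemma trm_op_in:
  assumes "in_variety A V" "nary V n t" "length as = n" "set as \<subseteq> univ A"
  shows "trm_op A t as \<in> univ A"
proof -
  obtain a where "a \<in> univ A" using assms(1) unfolding in_variety_def by blast
  then obtain v where "range v \<subseteq> univ A" "\<forall>t. nary V n t \<longrightarrow> trm_op A t as = eval A v t"
    using trm_op_valuation[OF assms(3) _ assms(4), of _ V A] by blast
  then show ?thesis
    using assms eval_in_subuniverse[of V A "univ A" v t] unfolding in_variety_def nary_def by simp
qed

lemma trm_op_veq:
  fixes A :: "'s talg" and V :: "'s variety"
  assumes "in_variety A V" "veq V s t" "nary V n s" "nary V n t"
    "length as = n" "set as \<subseteq> univ A"
  shows "trm_op A s as = trm_op A t as"
proof -
  obtain a where "a \<in> univ A" using assms(1) unfolding in_variety_def by blast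
  then obtain v where v: "range v \<subseteq> univ A"
    and eval: "\<forall>t. nary V n t \<longrightarrow> trm_op A t as = eval A v t"
    using trm_op_valuation[OF assms(5) _ assms(6), of _ V A] by blast
  have "eval A v s = eval A v t" using assms(1,2) v unfolding veq_def holds_def by blast
  then show ?thesis using eval assms(3,4) by simp
qed

section \<open>Identities of the variety and clones of terms\<close>

lemma veq_refl: "wf_trm V t \<Longrightarrow> veq V t t"
  by (simp add: veq_def holds_def)

lemma veq_sym: "veq V s t \<Longrightarrow> veq V t s"
  by (auto simp: veq_def holds_def)

lemma veq_trans: "veq V r s \<Longrightarrow> veq V s t \<Longrightarrow> veq V r t"
  by (auto simp: veq_def holds_def)

lemma veq_subst:
  fixes V :: "'s variety" and \<sigma> :: "nat \<Rightarrow> 's trm"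
  assumes "veq V s t" "\<And>i. wf_trm V (\<sigma> i)"
  shows "veq V (subst \<sigma> s) (subst \<sigma> t)"
  unfolding veq_def
proof (intro conjI allI impI)
  show "wf_trm V (subst \<sigma> s)" "wf_trm V (subst \<sigma> t)"
    using assms unfolding veq_def by (auto intro: wf_subst)
  fix A :: "'s talg" assume A: "in_variety A V"
  show "holds A (subst \<sigma> s) (subst \<sigma> t)"
    unfolding holds_def eval_subst
  proof (intro allI impI)
    fix v :: "nat \<Rightarrow> 's trm set" assume v: "range v \<subseteq> univ A"
    have "range (\<lambda>i. eval A v (\<sigma> i)) \<subseteq> univ A"
      using A assms(2) eval_in_subuniverse[OF _ v] unfolding in_variety_def by auto
    then show "eval A (\<lambda>i. eval A v (\<sigma> i)) s = eval A (\<lambda>i. eval A v (\<sigma> i)) t"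
      using assms(1) A unfolding veq_def holds_def by blast
  qed
qed

lemma clone_wf: "clone V {t. wf_trm V t}"
  unfolding clone_def by (auto simp: veq_def intro!: wf_subst)

text \<open>Well-formed generators lie in the clone of all well-formed terms, so the intersection
  defining \<open>Clo\<close> is not over the empty collection.\<close>

lemma clone_Clo:
  assumes "\<And>t. t \<in> G \<Longrightarrow> wf_trm V t"
  shows "clone V (Clo V G)"
proof -
  have in_Clo: "t \<in> Clo V G" if "\<And>C. clone V C \<Longrightarrow> G \<subseteq> C \<Longrightarrow> t \<in> C" for t
    using that unfolding Clo_def by blast
  have Clo_in: "t \<in> C" if "t \<in> Clo V G" "clone V C" "G \<subseteq> C" for t C
    using that unfolding Clo_def by blast
  show ?thesis
    unfolding clone_def
  proof (intro conjI ballI allI impI)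
    show "Clo V G \<subseteq> {t. wf_trm V t}" using Clo_in[OF _ clone_wf] assms by blast
    show "range Var \<subseteq> Clo V G" using in_Clo unfolding clone_def by blast
    fix t and \<sigma> :: "nat \<Rightarrow> 'a trm"
    assume t: "t \<in> Clo V G" and \<sigma>: "range \<sigma> \<subseteq> Clo V G"
    show "subst \<sigma> t \<in> Clo V G"
    proof (rule in_Clo)
      fix C assume C: "clone V C" "G \<subseteq> C"
      then have "t \<in> C" "range \<sigma> \<subseteq> C" using t \<sigma> Clo_in by blast+
      then show "subst \<sigma> t \<in> C" using C(1) unfolding clone_def by blast
    qed
  next
    fix s t assume st: "s \<in> Clo V G \<and> veq V s t"
    show "t \<in> Clo V G"
    proof (rule in_Clo)
      fix C assume C: "clone V C" "G \<subseteq> C"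
      then have "s \<in> C" using st Clo_in by blast
      then show "t \<in> C" using C(1) st unfolding clone_def by blast
    qed
  qed
qed

lemma Clo_base: "t \<in> G \<Longrightarrow> t \<in> Clo V G"
  unfolding Clo_def by blast

lemma clone_Var: "clone V C \<Longrightarrow> Var i \<in> C"
  unfolding clone_def by blast

lemma clone_app:
  assumes "clone V C" "t \<in> C" "nary V n t" "length ss = n" "set ss \<subseteq> C"
  shows "app t ss \<in> C"
proof -
  \<comment> \<open>Clones are closed under substitutions with their whole range in
    \<open>C\<close>, so indices beyond the arguments are sent to variables.\<close>
  define \<sigma> where "\<sigma> i = (if i \<in> {1..length ss} then ss ! (i - 1) else Var i)" for i
  have "ss ! (i - 1) \<in> set ss" if "i \<in> {1..length ss}" for i
    using that by (intro nth_mem) auto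
  then have "range \<sigma> \<subseteq> C" unfolding \<sigma>_def using assms(1,5) clone_Var by fastforce
  then have "subst \<sigma> t \<in> C" using assms(1,2) unfolding clone_def by blast
  moreover have "subst \<sigma> t = app t ss"
    unfolding app_def by (rule subst_cong) (use assms(3,4) in \<open>auto simp: \<sigma>_def nary_def\<close>)
  ultimately show ?thesis by simp
qed

text \<open>Supplies the subclones to which minimality is applied. Preservation is phrased with
  valuations, so that it makes sense for terms of all arities at once.\<close>

lemma clone_preserving:
  fixes A :: "'s talg" and V :: "'s variety"
  assumes "clone V C" "in_variety A V" "S \<subseteq> univ A"
  shows "clone V {t \<in> C. \<forall>v. range v \<subseteq> S \<longrightarrow> eval A v t \<in> S}" (is "clone V ?D")
  unfolding clone_def
proof (intro conjI ballI allI impI)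
  show "?D \<subseteq> {t. wf_trm V t}" "range Var \<subseteq> ?D" using assms(1) unfolding clone_def by auto
  fix t and \<sigma> :: "nat \<Rightarrow> 's trm" assume t: "t \<in> ?D" and \<sigma>: "range \<sigma> \<subseteq> ?D"
  then have "subst \<sigma> t \<in> C" using assms(1) unfolding clone_def by blast
  moreover have "eval A v (subst \<sigma> t) \<in> S" if "range v \<subseteq> S" for v :: "nat \<Rightarrow> 's trm set"
  proof -
    have "range (\<lambda>i. eval A v (\<sigma> i)) \<subseteq> S" using that \<sigma> by auto
    then show ?thesis using t unfolding eval_subst by blast
  qed
  ultimately show "subst \<sigma> t \<in> ?D" by blast
next
  fix s t assume st: "s \<in> ?D \<and> veq V s t"
  then have "t \<in> C" using assms(1) unfolding clone_def by blast
  moreover have "eval A v t \<in> S" if v: "range v \<subseteq> S" for v :: "nat \<Rightarrow> 's trm set"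
  proof -
    have "eval A v s = eval A v t"
      using st assms(2,3) v unfolding veq_def holds_def by (meson subset_trans)
    moreover have "eval A v s \<in> S" using st v by blast
    ultimately show ?thesis by simp
  qed
  ultimately show "t \<in> ?D" by blast
qed


section \<open>The free algebra\<close>

lemma trm_class_eq_iff:
  assumes "nary V n s" "nary V n t"
  shows "trm_class V n s = trm_class V n t \<longleftrightarrow> veq V s t"
proof
  have "s \<in> trm_class V n s" using assms veq_refl by (auto simp: trm_class_def nary_def)
  then show "trm_class V n s = trm_class V n t \<Longrightarrow> veq V s t" by (auto simp: trm_class_def)
  show "veq V s t \<Longrightarrow> trm_class V n s = trm_class V n t"
    unfolding trm_class_def by (auto dest: veq_sym veq_trans)
qed

lemma veq_App:
  fixes V :: "'s variety"
  assumes "list_all2 (veq V) ss ts" "length ts = arity V F"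
  shows "veq V (App F ss) (App F ts)"
  unfolding veq_def
proof (intro conjI allI impI)
  show "wf_trm V (App F ss)" "wf_trm V (App F ts)"
    using assms by (auto simp: list_all2_conv_all_nth veq_def in_set_conv_nth)
  fix A :: "'s talg" assume A: "in_variety A V"
  show "holds A (App F ss) (App F ts)"
    unfolding holds_def
  proof (intro allI impI)
    fix v :: "nat \<Rightarrow> 's trm set" assume "range v \<subseteq> univ A"
    then have "map (eval A v) ss = map (eval A v) ts"
      using assms(1) A
      by (intro nth_equalityI) (auto simp: list_all2_conv_all_nth veq_def holds_def)
    then show "eval A v (App F ss) = eval A v (App F ts)" by simp
  qed
qed

lemma free_alg_intp:
  assumes "length ts = arity V F" "\<And>t. t \<in> set ts \<Longrightarrow> nary V n t"
  shows "intp (free_alg V n) F (map (trm_class V n) ts) = trm_class V n (App F ts)"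
proof -
  have 1: "veq V s (App F ts)"
    if "list_all2 (\<in>) us (map (trm_class V n) ts)" "veq V s (App F us)" for s us
  proof -
    have "list_all2 (veq V) us ts"
      using that(1) by (auto simp: list_all2_conv_all_nth trm_class_def)
    then show ?thesis by (rule veq_trans[OF that(2) veq_App[OF _ assms(1)]])
  qed
  have 2: "list_all2 (\<in>) ts (map (trm_class V n) ts)"
    using assms(2) veq_refl nth_mem
    by (fastforce simp: list_all2_conv_all_nth trm_class_def nary_def)
  show ?thesis
    unfolding trm_class_def[of V n "App F ts"] using 1 2 by (auto simp: free_alg_def)
qed

lemma free_alg_univ: "univ (free_alg V n) = trm_class V n ` {t. nary V n t}"
  by (simp add: free_alg_def)

lemma free_alg_eval:
  assumes "\<And>i. nary V n (r i)" "wf_trm V t"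
  shows "eval (free_alg V n) (\<lambda>i. trm_class V n (r i)) t = trm_class V n (subst r t)"
  using assms(2)
proof (induction t)
  case (App F ts)
  have ts: "map (eval (free_alg V n) (\<lambda>i. trm_class V n (r i))) ts
      = map (trm_class V n) (map (subst r) ts)"
    using App by auto
  have "nary V n s" if "s \<in> set (map (subst r) ts)" for s
    using that App.prems assms(1) wf_subst unfolding nary_def by (fastforce simp: vars_subst)
  then show ?case
    using App.prems free_alg_intp[of "map (subst r) ts" V F n]
    unfolding eval.simps subst.simps ts by simp
qed simp

text \<open>Every element is the class of a term, so validity of a defining identity amounts to
  validity in the variety of its substitution instances.\<close>

lemma free_alg_in_variety:
  fixes V :: "'s variety"
  assumes V: "is_variety V" and n: "n \<ge> 1"
  shows "in_variety (free_alg V n) V"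
  unfolding in_variety_def
proof (intro conjI)
  let ?A = "free_alg V n"
  show "univ ?A \<noteq> {}" using nary_Var[of 1 n V] n unfolding free_alg_univ by blast
  show "subuniverse V ?A (univ ?A)"
    unfolding subuniverse_def
  proof (intro conjI allI impI)
    fix F cs assume cs: "length cs = arity V F \<and> set cs \<subseteq> univ ?A"
    then have "\<forall>c\<in>set cs. \<exists>t. nary V n t \<and> c = trm_class V n t" unfolding free_alg_univ by auto
    then obtain r where r: "\<And>c. c \<in> set cs \<Longrightarrow> nary V n (r c) \<and> c = trm_class V n (r c)" by metis
    have "map (trm_class V n) (map r cs) = cs" using r by (simp add: map_idI)
    then have "intp ?A F cs = trm_class V n (App F (map r cs))"
      using free_alg_intp[of "map r cs" V F n] cs r by force
    moreover have "nary V n (App F (map r cs))" using r cs by (fastforce simp: nary_def)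
    ultimately show "intp ?A F cs \<in> univ ?A" unfolding free_alg_univ by blast
  qed simp
  show "\<forall>(s, t)\<in>idents V. holds ?A s t"
  proof (clarify, unfold holds_def, intro allI impI)
    fix s t and v :: "nat \<Rightarrow> 's trm set" assume st: "(s, t) \<in> idents V" and v: "range v \<subseteq> univ ?A"
    have wf: "wf_trm V s" "wf_trm V t" using V st unfolding is_variety_def by auto
    have st': "veq V s t" using st wf unfolding veq_def in_variety_def by blast
    have "\<exists>t. nary V n t \<and> v i = trm_class V n t" for i
    proof -
      have "v i \<in> univ ?A" using v by blast
      then show ?thesis unfolding free_alg_univ by blast
    qed
    then obtain r where r: "\<And>i. nary V n (r i)" "\<And>i. v i = trm_class V n (r i)" by metis
    have v': "v = (\<lambda>i. trm_class V n (r i))" using r by auto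
    have nary: "nary V n (subst r u)" if "wf_trm V u" for u
      unfolding nary_def vars_subst using that r(1) wf_subst[of V u r] unfolding nary_def by blast
    have "veq V (subst r s) (subst r t)"
      by (rule veq_subst[OF st']) (use r(1) in \<open>simp add: nary_def\<close>)
    then have "trm_class V n (subst r s) = trm_class V n (subst r t)"
      using trm_class_eq_iff[OF nary[OF wf(1)] nary[OF wf(2)]] by simp
    then show "eval ?A v s = eval ?A v t"
      unfolding v' using free_alg_eval[of V n r] r(1) wf by simp
  qed
qed

lemma free_alg_trm_op:
  assumes "nary V n t" "n \<ge> 1"
  shows "trm_op (free_alg V n) t (map (free_gen V n) [1..<Suc n]) = trm_class V n t"
proof -
  \<comment> \<open>\<open>free_alg_eval\<close> asks for \<open>n\<close>-ary terms at all indices;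
    those outside \<open>1, ..., n\<close> do not occur in \<open>t\<close> and get
    \<open>Var 1\<close>.\<close>
  define r where "r i = (if i \<in> {1..n} then Var i else Var 1 :: 'a trm)" for i
  have r: "nary V n (r i)" for i unfolding r_def using nary_Var assms(2) by auto
  have "trm_op (free_alg V n) t (map (free_gen V n) [1..<Suc n])
      = eval (free_alg V n) (\<lambda>i. trm_class V n (r i)) t"
    unfolding eval_eq_trm_op[OF assms(1)] free_gen_def r_def
    by (rule arg_cong[where f = "trm_op _ _"]) (simp del: upt_Suc)
  also have "\<dots> = trm_class V n (subst r t)"
    using assms(1) by (intro free_alg_eval r) (simp add: nary_def)
  also have "subst r t = subst Var t"
    by (rule subst_cong) (use assms in \<open>auto simp: r_def nary_def\<close>)
  finally show ?thesis by (simp add: subst_Var)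
qed

text \<open>Each element is the value of an \<open>n\<close>-ary term at the free generators, so the
  algebra is finitely generated and local finiteness applies.\<close>

lemma finite_free_alg:
  assumes "is_variety V" "locally_finite V" "n \<ge> 1"
  shows "finite (univ (free_alg V n))"
proof -
  let ?A = "free_alg V n" and ?X = "free_gen V n ` {1..n}"
  have A: "in_variety ?A V" using free_alg_in_variety assms by blast
  have X: "?X \<subseteq> univ ?A" unfolding free_alg_univ free_gen_def using nary_Var by fastforce
  have "univ ?A \<subseteq> generated V ?A ?X"
    unfolding generated_def
  proof clarify
    fix c S assume c: "c \<in> univ ?A" and S: "subuniverse V ?A S" "?X \<subseteq> S"
    obtain t where t: "nary V n t" "c = trm_class V n t" using c unfolding free_alg_univ by blast
    have "free_gen V n 1 \<in> S" using S assms(3) by auto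
    moreover have "set (map (free_gen V n) [1..<Suc n]) \<subseteq> S" using S by (auto simp del: upt_Suc)
    ultimately obtain v where "range v \<subseteq> S"
      "\<forall>t. nary V n t \<longrightarrow> trm_op ?A t (map (free_gen V n) [1..<Suc n]) = eval ?A v t"
      using trm_op_valuation[of "map (free_gen V n) [1..<Suc n]" n "free_gen V n 1" S V ?A]
      by (auto simp del: upt_Suc)
    then show "c \<in> S"
      using free_alg_trm_op[OF t(1) assms(3)] t eval_in_subuniverse[OF S(1), of v t]
      unfolding nary_def by simp
  qed
  then have "generated V ?A ?X = univ ?A"
    using A X unfolding generated_def in_variety_def by blast
  then show ?thesis using assms(2) A X unfolding locally_finite_def by blast
qed


section \<open>Symmetric families of terms\<close>

definition principal_family :: "nat \<Rightarrow> nat \<Rightarrow> nat set set" where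
  "principal_family n i = {S. S \<subseteq> {1..n} \<and> i \<in> S}"

definition majority3 :: "nat set set" where
  "majority3 = {{1, 2}, {1, 3}, {2, 3}, {1, 2, 3}}"

text \<open>The majorities among four voters when the first one breaks ties.\<close>

definition majority4 :: "nat set set" where
  "majority4 = {{1, 2}, {1, 3}, {1, 4}, {1, 2, 3}, {1, 2, 4}, {1, 3, 4}, {2, 3, 4}, {1, 2, 3, 4}}"

lemma majority3_mem: "{1, 2} \<in> majority3" "{1, 3} \<in> majority3" "{2, 3} \<in> majority3"
  by (simp_all add: majority3_def)

lemma majority4_mem:
  "{1, 2} \<in> majority4" "{1, 3} \<in> majority4" "{1, 4} \<in> majority4" "{1, 2, 3} \<in> majority4"
  "{1, 2, 4} \<in> majority4" "{1, 3, 4} \<in> majority4" "{2, 3, 4} \<in> majority4"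
  by (simp_all add: majority4_def)

lemma principal_mem: "S \<in> principal_family n i \<longleftrightarrow> S \<subseteq> {1..n} \<and> i \<in> S"
  by (simp add: principal_family_def)

text \<open>The majority families yield the identities of bounded width. The principal families,
  which behave like projections, are carried along for the induction step
  \<open>symmetrisable_comp\<close>.\<close>

definition families :: "(nat \<times> nat set set) set" where
  "families = {(3, majority3), (4, majority4)} \<union> {(n, principal_family n i) | n i. n \<in> {3, 4} \<and> i \<in> {1..n}}"

text \<open>A larger intersecting family with a new member \<open>S\<close> would also contain the
  complement of \<open>S\<close>, which is disjoint from it.\<close>

lemma max_intersectingI:
  assumes "\<F> \<subseteq> Pow {1..n}" "intersecting \<F>"
    and "\<And>S. S \<subseteq> {1..n} \<Longrightarrow> S \<in> \<F> \<or> {1..n} - S \<in> \<F>"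
  shows "max_intersecting n \<F>"
  unfolding max_intersecting_def
proof (intro conjI allI impI)
  fix \<G> assume \<G>: "\<G> \<subseteq> Pow {1..n} \<and> intersecting \<G> \<and> \<F> \<subseteq> \<G>"
  have "S \<in> \<F>" if S: "S \<in> \<G>" for S
  proof (rule ccontr)
    assume "S \<notin> \<F>"
    moreover have "S \<subseteq> {1..n}" using S \<G> by blast
    ultimately have "{1..n} - S \<in> \<G>" using assms(3) \<G> by blast
    then have "S \<inter> ({1..n} - S) \<noteq> {}" using S \<G> unfolding intersecting_def by blast
    then show False by blast
  qed
  then show "\<G> = \<F>" using \<G> by blast
qed (use assms in auto)

lemma max_intersecting_principal:
  assumes "i \<in> {1..n}"
  shows "max_intersecting n (principal_family n i)"
  by (rule max_intersectingI) (use assms in \<open>auto simp: principal_family_def intersecting_def\<close>)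

lemma atLeastAtMost_numeral: "{1..2::nat} = {1, 2}" "{1..3::nat} = {1, 2, 3}" "{1..4::nat} = {1, 2, 3, 4}"
  by auto

lemma max_intersecting_majority3: "max_intersecting 3 majority3"
proof (rule max_intersectingI)
  show "majority3 \<subseteq> Pow {1..3}" "intersecting majority3"
    by (auto simp: majority3_def intersecting_def)
  fix S :: "nat set" assume "S \<subseteq> {1..3}"
  then have "S \<in> Pow {1, 2, 3}" unfolding atLeastAtMost_numeral by blast
  then show "S \<in> majority3 \<or> {1..3} - S \<in> majority3"
    unfolding majority3_def atLeastAtMost_numeral Pow_insert Pow_empty
    by (elim UnE imageE insertE emptyE) (simp_all add: insert_Diff_if insert_commute)
qed

lemma max_intersecting_majority4: "max_intersecting 4 majority4"
proof (rule max_intersectingI)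
  show "majority4 \<subseteq> Pow {1..4}" "intersecting majority4"
    by (auto simp: majority4_def intersecting_def)
  fix S :: "nat set" assume "S \<subseteq> {1..4}"
  then have "S \<in> Pow {1, 2, 3, 4}" unfolding atLeastAtMost_numeral by blast
  then show "S \<in> majority4 \<or> {1..4} - S \<in> majority4"
    unfolding majority4_def atLeastAtMost_numeral Pow_insert Pow_empty
    by (elim UnE imageE insertE emptyE) (simp_all add: insert_Diff_if insert_commute)
qed

lemma families_max_intersecting:
  assumes "(n, \<F>) \<in> families"
  shows "n \<in> {3, 4}" "max_intersecting n \<F>"
  using assms max_intersecting_principal max_intersecting_majority3 max_intersecting_majority4
  unfolding families_def by auto

lemma max_intersecting_nonempty: "max_intersecting n \<F> \<Longrightarrow> S \<in> \<F> \<Longrightarrow> S \<noteq> {} \<and> S \<subseteq> {1..n}"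
  unfolding max_intersecting_def intersecting_def by blast

section \<open>Argument lists with at most two values\<close>

definition pattern :: "nat \<Rightarrow> nat set \<Rightarrow> 'a \<Rightarrow> 'a \<Rightarrow> 'a list" where
  "pattern n S x y = map (\<lambda>i. if i \<in> S then x else y) [1..<Suc n]"

lemma pattern_numeral:
  "pattern 3 S x y = [if 1 \<in> S then x else y, if 2 \<in> S then x else y, if 3 \<in> S then x else y]"
  "pattern 4 S x y = [if 1 \<in> S then x else y, if 2 \<in> S then x else y, if 3 \<in> S then x else y,
     if 4 \<in> S then x else y]"
proof -
  have "[1..<Suc 3] = [1, 2, 3]" "[1..<Suc 4] = [1, 2, 3, 4]"
    by (simp_all add: numeral_eq_Suc)
  then show
    "pattern 3 S x y = [if 1 \<in> S then x else y, if 2 \<in> S then x else y, if 3 \<in> S then x else y]"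
    "pattern 4 S x y = [if 1 \<in> S then x else y, if 2 \<in> S then x else y, if 3 \<in> S then x else y,
       if 4 \<in> S then x else y]"
    unfolding pattern_def by simp_all
qed

lemma length_pattern [simp]: "length (pattern n S x y) = n"
  by (simp add: pattern_def del: upt_Suc)

lemma pattern_compl: "pattern n ({1..n} - S) x y = pattern n S y x"
  by (auto simp: pattern_def simp del: upt_Suc)

lemma list_eq_pattern:
  assumes "length as = n" "set as \<subseteq> {x, y}"
  shows "as = pattern n {i \<in> {1..n}. as ! (i - 1) = x} x y"
proof (rule nth_equalityI)
  fix i assume i: "i < length as"
  then have "as ! i \<in> {x, y}" using assms nth_mem by blast
  then show "as ! i = pattern n {i \<in> {1..n}. as ! (i - 1) = x} x y ! i"
    using i assms by (auto simp: pattern_def simp del: upt_Suc)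
qed (simp add: assms)

text \<open>Idempotence of the basic operations makes \<open>{x}\<close> a subuniverse, and terms
  preserve subuniverses.\<close>

lemma trm_op_idem:
  fixes A :: "'s talg" and V :: "'s variety"
  assumes "idempotent_variety V" "in_variety A V" "nary V n t" "x \<in> univ A"
  shows "trm_op A t (replicate n x) = x"
proof -
  have "intp A F as = x" if as: "length as = arity V F" "set as \<subseteq> {x}" for F as
  proof -
    have "as = replicate (arity V F) x" using as by (metis replicate_eqI singletonD subsetD)
    moreover have "holds A (App F (replicate (arity V F) (Var 1))) (Var 1)"
      using assms(1,2) unfolding idempotent_variety_def veq_def by blast
    then have "eval A (\<lambda>i. x) (App F (replicate (arity V F) (Var 1))) = eval A (\<lambda>i. x) (Var 1)"
      using assms(4) unfolding holds_def by (metis image_subsetI)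
    ultimately show ?thesis by simp
  qed
  then have "subuniverse V A {x}" unfolding subuniverse_def using assms(4) by auto
  then have "eval A (\<lambda>i. x) t = x"
    using eval_in_subuniverse[of V A "{x}" "\<lambda>i. x" t] assms(3) unfolding nary_def by auto
  moreover have "trm_op A t (replicate n x) = eval A (\<lambda>i. x) t"
    unfolding trm_op_def
  proof (rule eval_cong)
    fix i assume "i \<in> vars t"
    then have "i - 1 < n" using assms(3) unfolding nary_def by fastforce
    then show "replicate n x ! (i - 1) = x" by simp
  qed
  ultimately show ?thesis by simp
qed

section \<open>A standard pair with minimal clone, and its identities inside an algebra\<close>

locale minimal_pair =
  fixes V :: "'s variety" and f g :: "'s trm" and h :: "nat \<Rightarrow> nat set set \<Rightarrow> 's trm"
  assumes idempotent: "idempotent_variety V"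
    and nary_f: "nary V 2 f" and nary_g: "nary V 3 g"
    and g_near_unanimous:
      "veq V (app g [Var 1, Var 1, Var 2]) (app f [Var 1, Var 2])"
      "veq V (app g [Var 1, Var 2, Var 1]) (app f [Var 1, Var 2])"
      "veq V (app g [Var 2, Var 1, Var 1]) (app f [Var 1, Var 2])"
    and f_absorb: "veq V (app f [app f [Var 1, Var 2], app f [Var 2, Var 1]]) (app f [Var 1, Var 2])"
    and h_Clo: "n \<ge> 2 \<Longrightarrow> max_intersecting n \<F> \<Longrightarrow> h n \<F> \<in> Clo V {g}"
    and nary_h: "n \<ge> 2 \<Longrightarrow> max_intersecting n \<F> \<Longrightarrow> nary V n (h n \<F>)"
    and h_symmetric: "n \<ge> 2 \<Longrightarrow> max_intersecting n \<F> \<Longrightarrow> a ` {1..n} = {Var 1, Var 2} \<Longrightarrow>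
      {i\<in>{1..n}. a i = Var 1} \<in> \<F> \<Longrightarrow> veq V (app (h n \<F>) (map a [1..<Suc n])) (app f [Var 1, Var 2])"
    and semilattice: "t \<in> Clo V {h n \<F> | n \<F>. n \<ge> 2 \<and> max_intersecting n \<F>} \<Longrightarrow> nary V 2 t \<Longrightarrow>
      in_variety (A :: 's talg) V \<Longrightarrow> c \<in> univ A \<Longrightarrow> d \<in> univ A \<Longrightarrow> c \<noteq> d \<Longrightarrow>
      trm_op A t [c, d] = c \<Longrightarrow> trm_op A t [d, c] = c \<Longrightarrow>
      trm_op A f [c, d] = c \<and> trm_op A f [d, c] = c"
    and minimal: "minimal_bounded_width V (Clo V {g})"
begin

lemma clone_Clo_g: "clone V (Clo V {g})"
  using minimal unfolding minimal_bounded_width_def by blast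

lemma f_Clo_g: "f \<in> Clo V {g}"
proof -
  have "app g [Var 1, Var 1, Var 2] \<in> Clo V {g}"
    by (rule clone_app[OF clone_Clo_g _ nary_g]) (auto intro: Clo_base clone_Var[OF clone_Clo_g])
  then show ?thesis
    using g_near_unanimous(1) clone_Clo_g unfolding clone_def app_Var[OF nary_f] by metis
qed

context
  fixes A :: "'s talg"
  assumes A: "in_variety A V"
begin

lemma f_in: "x \<in> univ A \<Longrightarrow> y \<in> univ A \<Longrightarrow> trm_op A f [x, y] \<in> univ A"
  by (rule trm_op_in[OF A nary_f]) simp_all

lemma f_idem: "x \<in> univ A \<Longrightarrow> trm_op A f [x, x] = x"
  using trm_op_idem[OF idempotent A nary_f] by (simp add: numeral_2_eq_2)

lemma identity:
  assumes "veq V (app s ss) (app t ts)" "nary V m s" "length ss = m" "nary V n t" "length ts = n"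
    and "\<forall>r\<in>set ss. nary V 2 r" "\<forall>r\<in>set ts. nary V 2 r" and "x \<in> univ A" "y \<in> univ A"
  shows "trm_op A s (map (\<lambda>r. trm_op A r [x, y]) ss) = trm_op A t (map (\<lambda>r. trm_op A r [x, y]) ts)"
proof -
  have "trm_op A (app s ss) [x, y] = trm_op A (app t ts) [x, y]"
    using assms(8,9)
    by (intro trm_op_veq[OF A assms(1), of 2] nary_app[OF assms(2,3,6)] nary_app[OF assms(4,5,7)]) auto
  then show ?thesis using trm_op_app[OF assms(2,3)] trm_op_app[OF assms(4,5)] by metis
qed

lemma g_op:
  assumes "x \<in> univ A" "y \<in> univ A"
  shows "trm_op A g [x, x, y] = trm_op A f [x, y]" "trm_op A g [x, y, x] = trm_op A f [x, y]"
    "trm_op A g [y, x, x] = trm_op A f [x, y]"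
  using g_near_unanimous[THEN identity, OF nary_g _ nary_f _ _ _ assms]
  by (simp_all add: trm_op_Var nary_Var)

lemma f_op_absorb:
  assumes "x \<in> univ A" "y \<in> univ A"
  shows "trm_op A f [trm_op A f [x, y], trm_op A f [y, x]] = trm_op A f [x, y]"
proof -
  have "nary V 2 (app f [Var i, Var j])" if "i \<in> {1, 2}" "j \<in> {1, 2}" for i j
    by (rule nary_app[OF nary_f]) (use that in \<open>auto simp: nary_Var\<close>)
  then show ?thesis
    using f_absorb[THEN identity, OF nary_f _ nary_f _ _ _ assms]
    by (simp add: trm_op_Var nary_Var trm_op_app[OF nary_f])
qed

text \<open>The index \<open>j\<close> outside \<open>S\<close> ensures that both variables occur,
  as \<open>h_symmetric\<close> demands.\<close>

lemma h_op:
  assumes "n \<ge> 2" "max_intersecting n \<F>" "S \<in> \<F>" "j \<in> {1..n} - S" "x \<in> univ A" "y \<in> univ A"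
  shows "trm_op A (h n \<F>) (pattern n S x y) = trm_op A f [x, y]"
proof -
  let ?a = "\<lambda>i. if i \<in> S then Var 1 else Var 2 :: 's trm"
  have S: "S \<noteq> {}" "S \<subseteq> {1..n}" using max_intersecting_nonempty assms by blast+
  then have "?a ` {1..n} = {Var 1, Var 2}" using assms(4) by (auto simp: image_iff)
  moreover have "{i\<in>{1..n}. ?a i = Var 1} = S" using S(2) by auto
  moreover have nary: "\<forall>r\<in>set (map ?a [1..<Suc n]). nary V 2 r" by (auto simp: nary_Var)
  ultimately have "veq V (app (h n \<F>) (map ?a [1..<Suc n])) (app f [Var 1, Var 2])"
    using h_symmetric[OF assms(1,2), of ?a] assms(3) by simp
  then have "trm_op A (h n \<F>) (map (\<lambda>r. trm_op A r [x, y]) (map ?a [1..<Suc n])) = trm_op A f [x, y]"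
    using identity[OF _ nary_h[OF assms(1,2)] _ nary_f _ _ _ assms(5,6), of "map ?a [1..<Suc n]" "[Var 1, Var 2]"] nary
    by (simp add: trm_op_Var nary_Var del: upt_Suc set_map)
  moreover have "map (\<lambda>r. trm_op A r [x, y]) (map ?a [1..<Suc n]) = pattern n S x y"
    by (auto simp: pattern_def trm_op_Var simp del: upt_Suc)
  ultimately show ?thesis by simp
qed

text \<open>This table and the next one let the simplifier evaluate the terms for
  \<open>twist\<close>.\<close>

lemma h3_op:
  assumes "x \<in> univ A" "y \<in> univ A"
  shows "trm_op A (h 3 majority3) [x, x, x] = x"
    "trm_op A (h 3 majority3) [x, x, y] = trm_op A f [x, y]"
    "trm_op A (h 3 majority3) [x, y, x] = trm_op A f [x, y]"
    "trm_op A (h 3 majority3) [y, x, x] = trm_op A f [x, y]"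
    "trm_op A (h 3 (principal_family 3 1)) [x, x, y] = trm_op A f [x, y]"
    "trm_op A (h 3 (principal_family 3 1)) [x, y, x] = trm_op A f [x, y]"
    "trm_op A (h 3 (principal_family 3 1)) [x, y, y] = trm_op A f [x, y]"
proof -
  show "trm_op A (h 3 majority3) [x, x, x] = x"
    using trm_op_idem[OF idempotent A nary_h[OF _ max_intersecting_majority3] assms(1)]
    by (simp add: numeral_3_eq_3)
  have m: "trm_op A (h 3 majority3) (pattern 3 S x y) = trm_op A f [x, y]"
    if "S \<in> majority3" "j \<in> {1..3} - S" for S j
    by (rule h_op[OF _ max_intersecting_majority3 that assms]) simp
  show "trm_op A (h 3 majority3) [x, x, y] = trm_op A f [x, y]"
    "trm_op A (h 3 majority3) [x, y, x] = trm_op A f [x, y]"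
    "trm_op A (h 3 majority3) [y, x, x] = trm_op A f [x, y]"
    using m[of "{1, 2}" 3] m[of "{1, 3}" 2] m[of "{2, 3}" 1]
    by (simp_all add: pattern_numeral majority3_mem del: One_nat_def)
  have p: "trm_op A (h 3 (principal_family 3 1)) (pattern 3 S x y) = trm_op A f [x, y]"
    if "S \<in> principal_family 3 1" "j \<in> {1..3} - S" for S j
    by (rule h_op[OF _ max_intersecting_principal that assms]) simp_all
  show "trm_op A (h 3 (principal_family 3 1)) [x, x, y] = trm_op A f [x, y]"
    "trm_op A (h 3 (principal_family 3 1)) [x, y, x] = trm_op A f [x, y]"
    "trm_op A (h 3 (principal_family 3 1)) [x, y, y] = trm_op A f [x, y]"
    using p[of "{1, 2}" 3] p[of "{1, 3}" 2] p[of "{1}" 2]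
    by (simp_all add: pattern_numeral principal_mem del: One_nat_def)
qed

lemma h4_op:
  assumes "x \<in> univ A" "y \<in> univ A"
  shows "trm_op A (h 4 majority4) [x, x, y, y] = trm_op A f [x, y]"
    "trm_op A (h 4 majority4) [x, y, x, y] = trm_op A f [x, y]"
    "trm_op A (h 4 majority4) [x, y, y, x] = trm_op A f [x, y]"
    "trm_op A (h 4 majority4) [x, x, x, y] = trm_op A f [x, y]"
    "trm_op A (h 4 majority4) [x, x, y, x] = trm_op A f [x, y]"
    "trm_op A (h 4 majority4) [x, y, x, x] = trm_op A f [x, y]"
    "trm_op A (h 4 majority4) [y, x, x, x] = trm_op A f [x, y]"
    "trm_op A (h 4 (principal_family 4 1)) [x, x, x, y] = trm_op A f [x, y]"
    "trm_op A (h 4 (principal_family 4 1)) [x, x, y, x] = trm_op A f [x, y]"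
    "trm_op A (h 4 (principal_family 4 1)) [x, y, x, x] = trm_op A f [x, y]"
    "trm_op A (h 4 (principal_family 4 1)) [x, x, y, y] = trm_op A f [x, y]"
    "trm_op A (h 4 (principal_family 4 1)) [x, y, x, y] = trm_op A f [x, y]"
    "trm_op A (h 4 (principal_family 4 1)) [x, y, y, x] = trm_op A f [x, y]"
    "trm_op A (h 4 (principal_family 4 1)) [x, y, y, y] = trm_op A f [x, y]"
proof -
  have m: "trm_op A (h 4 majority4) (pattern 4 S x y) = trm_op A f [x, y]"
    if "S \<in> majority4" "j \<in> {1..4} - S" for S j
    by (rule h_op[OF _ max_intersecting_majority4 that assms]) simp
  show "trm_op A (h 4 majority4) [x, x, y, y] = trm_op A f [x, y]"
    "trm_op A (h 4 majority4) [x, y, x, y] = trm_op A f [x, y]"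
    "trm_op A (h 4 majority4) [x, y, y, x] = trm_op A f [x, y]"
    "trm_op A (h 4 majority4) [x, x, x, y] = trm_op A f [x, y]"
    "trm_op A (h 4 majority4) [x, x, y, x] = trm_op A f [x, y]"
    "trm_op A (h 4 majority4) [x, y, x, x] = trm_op A f [x, y]"
    "trm_op A (h 4 majority4) [y, x, x, x] = trm_op A f [x, y]"
    using m[of "{1, 2}" 3] m[of "{1, 3}" 2] m[of "{1, 4}" 2] m[of "{1, 2, 3}" 4] m[of "{1, 2, 4}" 3]
      m[of "{1, 3, 4}" 2] m[of "{2, 3, 4}" 1]
    by (simp_all add: pattern_numeral majority4_mem del: One_nat_def)
  have p: "trm_op A (h 4 (principal_family 4 1)) (pattern 4 S x y) = trm_op A f [x, y]"
    if "S \<in> principal_family 4 1" "j \<in> {1..4} - S" for S j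
    by (rule h_op[OF _ max_intersecting_principal that assms]) simp_all
  show "trm_op A (h 4 (principal_family 4 1)) [x, x, x, y] = trm_op A f [x, y]"
    "trm_op A (h 4 (principal_family 4 1)) [x, x, y, x] = trm_op A f [x, y]"
    "trm_op A (h 4 (principal_family 4 1)) [x, y, x, x] = trm_op A f [x, y]"
    "trm_op A (h 4 (principal_family 4 1)) [x, x, y, y] = trm_op A f [x, y]"
    "trm_op A (h 4 (principal_family 4 1)) [x, y, x, y] = trm_op A f [x, y]"
    "trm_op A (h 4 (principal_family 4 1)) [x, y, y, x] = trm_op A f [x, y]"
    "trm_op A (h 4 (principal_family 4 1)) [x, y, y, y] = trm_op A f [x, y]"
    using p[of "{1, 2, 3}" 4] p[of "{1, 2, 4}" 3] p[of "{1, 3, 4}" 2] p[of "{1, 2}" 3] p[of "{1, 3}" 2]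
      p[of "{1, 4}" 2] p[of "{1}" 2]
    by (simp_all add: pattern_numeral principal_mem del: One_nat_def)
qed

end

end

text \<open>If neither set could be added to the family, it would have a member disjoint from
  \<open>S\<close> and a member inside \<open>S\<close>, and these two would not meet.\<close>

lemma max_intersecting_compl:
  assumes "max_intersecting n \<F>" "S \<subseteq> {1..n}" "S \<noteq> {}" "S \<noteq> {1..n}"
  shows "S \<in> \<F> \<or> {1..n} - S \<in> \<F>"
proof (rule ccontr)
  assume "\<not> ?thesis"
  then have notin: "S \<notin> \<F>" "{1..n} - S \<notin> \<F>" by auto
  have disj: "\<exists>T\<in>\<F>. T \<inter> S' = {}" if S': "S' \<subseteq> {1..n}" "S' \<noteq> {}" "S' \<notin> \<F>" for S'
  proof (rule ccontr)
    assume "\<not> ?thesis"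
    then have "A \<inter> S' \<noteq> {}" if "A \<in> \<F>" for A using that by blast
    then have "intersecting (insert S' \<F>)"
      using assms(1) S'(2) unfolding max_intersecting_def intersecting_def by (simp add: Int_commute)
    then have "insert S' \<F> = \<F>"
      using assms(1) S'(1) unfolding max_intersecting_def by (simp add: subset_insertI)
    then show False using S'(3) by blast
  qed
  obtain T where T: "T \<in> \<F>" "T \<inter> S = {}" using disj[of S] assms notin by blast
  obtain T' where T': "T' \<in> \<F>" "T' \<inter> ({1..n} - S) = {}"
    using disj[of "{1..n} - S"] assms notin by blast
  have "T \<inter> T' \<noteq> {}" using assms(1) T(1) T'(1) unfolding max_intersecting_def intersecting_def by blast
  moreover have "T \<subseteq> {1..n}" using assms(1) T(1) unfolding max_intersecting_def by blast
  ultimately show False using T(2) T'(2) by blast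
qed

section \<open>Terms that can take the place of \<open>f\<close>\<close>

context minimal_pair
begin

definition clone_term :: "nat \<Rightarrow> 's trm \<Rightarrow> bool" where
  "clone_term n t \<longleftrightarrow> t \<in> Clo V {g} \<and> nary V n t"

lemma clone_term_app:
  "clone_term m t \<Longrightarrow> length ss = m \<Longrightarrow> \<forall>s\<in>set ss. clone_term n s \<Longrightarrow> clone_term n (app t ss)"
  unfolding clone_term_def using clone_app[OF clone_Clo_g, of t m ss] nary_app[of V m t ss n] by blast

lemma clone_term_Var: "1 \<le> i \<Longrightarrow> i \<le> n \<Longrightarrow> clone_term n (Var i)"
  unfolding clone_term_def using clone_Var[OF clone_Clo_g] nary_Var by blast

lemma clone_term_f: "clone_term 2 f"
  unfolding clone_term_def using f_Clo_g nary_f by blast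

lemma clone_term_h: "n \<ge> 2 \<Longrightarrow> max_intersecting n \<F> \<Longrightarrow> clone_term n (h n \<F>)"
  unfolding clone_term_def using h_Clo nary_h by blast

text \<open>\<open>s\<close> does for \<open>t\<close> what \<open>h n \<F>\<close> does for
  \<open>f\<close>. Speaking of values in algebras allows direct computation;
  \<open>realises_veq\<close> returns to identities.\<close>

definition realises :: "nat \<Rightarrow> nat set set \<Rightarrow> 's trm \<Rightarrow> 's trm \<Rightarrow> bool" where
  "realises n \<F> t s \<longleftrightarrow> clone_term n s \<and>
     (\<forall>(A :: 's talg) x y S j. in_variety A V \<and> x \<in> univ A \<and> y \<in> univ A \<and> S \<in> \<F> \<and> j \<in> {1..n} - S \<longrightarrow>
        trm_op A s (pattern n S x y) = trm_op A t [x, y])"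

definition symmetrisable :: "'s trm \<Rightarrow> bool" where
  "symmetrisable t \<longleftrightarrow> clone_term 2 t \<and> (\<forall>n \<F>. (n, \<F>) \<in> families \<longrightarrow> (\<exists>s. realises n \<F> t s))"

lemma realisesI:
  assumes "clone_term n s"
    and "\<And>(A :: 's talg) x y S j. in_variety A V \<Longrightarrow> x \<in> univ A \<Longrightarrow> y \<in> univ A \<Longrightarrow> S \<in> \<F> \<Longrightarrow>
      j \<in> {1..n} \<Longrightarrow> j \<notin> S \<Longrightarrow> trm_op A s (pattern n S x y) = trm_op A t [x, y]"
  shows "realises n \<F> t s"
  using assms unfolding realises_def by blast

lemma realises_op:
  fixes A :: "'s talg"
  assumes "realises n \<F> t s" "in_variety A V" "S \<in> \<F>" "j \<in> {1..n}" "j \<notin> S" "x \<in> univ A" "y \<in> univ A"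
  shows "trm_op A s (pattern n S x y) = trm_op A t [x, y]"
  using assms unfolding realises_def by blast

lemma symmetrisable_realises:
  assumes "symmetrisable t" "(n, \<F>) \<in> families"
  obtains s where "realises n \<F> t s"
  using assms unfolding symmetrisable_def by blast

lemma symmetrisable_base: "symmetrisable f"
  unfolding symmetrisable_def
proof (intro conjI allI impI)
  show "clone_term 2 f" by (rule clone_term_f)
  fix n \<F> assume "(n, \<F>) \<in> families"
  then have F: "n \<ge> 2" "max_intersecting n \<F>" using families_max_intersecting by force+
  have "realises n \<F> f (h n \<F>)"
    using F by (intro realisesI clone_term_h h_op) auto
  then show "\<exists>s. realises n \<F> f s" by blast
qed

lemma symmetrisable_join:
  assumes "symmetrisable t" "symmetrisable t'"
  shows "symmetrisable (app f [t, t'])"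
  unfolding symmetrisable_def
proof (intro conjI allI impI)
  have tt: "clone_term 2 t" "clone_term 2 t'" using assms unfolding symmetrisable_def by auto
  then show "clone_term 2 (app f [t, t'])" by (intro clone_term_app[OF clone_term_f]) auto
  fix n \<F> assume F: "(n, \<F>) \<in> families"
  obtain s where s: "realises n \<F> t s" using symmetrisable_realises[OF assms(1) F] .
  obtain s' where s': "realises n \<F> t' s'" using symmetrisable_realises[OF assms(2) F] .
  have "realises n \<F> (app f [t, t']) (app f [s, s'])"
  proof (rule realisesI)
    show "clone_term n (app f [s, s'])"
      using s s' unfolding realises_def by (simp add: clone_term_app[OF clone_term_f])
  qed (simp add: trm_op_app[OF nary_f] realises_op[OF s] realises_op[OF s'])
  then show "\<exists>s. realises n \<F> (app f [t, t']) s" by blast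
qed

text \<open>Into the term \<open>s'\<close> for \<open>t'\<close> insert terms \<open>p i\<close>
  that realise \<open>t\<close> on the principal families. When \<open>x\<close> occupies exactly
  the positions in \<open>S\<close>, \<open>p i\<close> gives \<open>t(x, y)\<close> for
  \<open>i\<close> in \<open>S\<close> and \<open>t(y, x)\<close> otherwise, so \<open>s'\<close>
  again receives a list with pattern \<open>S\<close>.\<close>

lemma symmetrisable_comp:
  assumes "symmetrisable t" "symmetrisable t'"
  shows "symmetrisable (app t' [t, app t [Var 2, Var 1]])"
  unfolding symmetrisable_def
proof (intro conjI allI impI)
  have tt: "clone_term 2 t" "clone_term 2 t'" using assms unfolding symmetrisable_def by auto
  then have nary: "nary V 2 t" "nary V 2 t'" unfolding clone_term_def by auto
  have op: "trm_op A (app t' [t, app t [Var 2, Var 1]]) [x, y]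
      = trm_op A t' [trm_op A t [x, y], trm_op A t [y, x]]" for A :: "'s talg" and x y
    by (simp add: trm_op_app[OF nary(1)] trm_op_app[OF nary(2)] trm_op_Var)
  have "clone_term 2 (app t [Var 2, Var 1])"
    by (rule clone_term_app[OF tt(1)]) (auto intro: clone_term_Var)
  then show "clone_term 2 (app t' [t, app t [Var 2, Var 1]])"
    using tt by (intro clone_term_app[OF tt(2)]) auto
  fix n \<F> assume F: "(n, \<F>) \<in> families"
  obtain s' where s': "realises n \<F> t' s'" using symmetrisable_realises[OF assms(2) F] .
  have "\<exists>s. realises n (principal_family n i) t s" if "i \<in> {1..n}" for i
  proof -
    have "(n, principal_family n i) \<in> families"
      using families_max_intersecting(1)[OF F] that unfolding families_def by blast
    then show ?thesis using symmetrisable_realises[OF assms(1)] by blast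
  qed
  then obtain p where p: "\<And>i. i \<in> {1..n} \<Longrightarrow> realises n (principal_family n i) t (p i)" by metis
  have "realises n \<F> (app t' [t, app t [Var 2, Var 1]]) (app s' (map p [1..<Suc n]))"
  proof (rule realisesI)
    have s'': "clone_term n s'" "nary V n s'" using s' unfolding realises_def clone_term_def by auto
    show "clone_term n (app s' (map p [1..<Suc n]))"
      using p by (intro clone_term_app[OF s''(1)]) (auto simp: realises_def simp del: upt_Suc)
    fix A :: "'s talg" and x y S j
    assume A: "in_variety A V" and xy: "x \<in> univ A" "y \<in> univ A"
      and S: "S \<in> \<F>" "j \<in> {1..n}" "j \<notin> S"
    have S': "S \<noteq> {}" "S \<subseteq> {1..n}"
      using max_intersecting_nonempty[OF families_max_intersecting(2)[OF F] S(1)] by auto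
    have "trm_op A (p i) (pattern n S x y) = (if i \<in> S then trm_op A t [x, y] else trm_op A t [y, x])"
      if i: "i \<in> {1..n}" for i
    proof (cases "i \<in> S")
      case True
      then show ?thesis
        using realises_op[OF p[OF i] A, of S j x y] S S' xy by (simp add: principal_mem)
    next
      case False
      \<comment> \<open>With the roles of \<open>x\<close> and \<open>y\<close> exchanged, the
        relevant set is the complement of \<open>S\<close>; it contains \<open>i\<close> and misses
        \<open>k\<close>.\<close>
      obtain k where k: "k \<in> S" using S' by blast
      have "trm_op A (p i) (pattern n ({1..n} - S) y x) = trm_op A t [y, x]"
        using k False i S' xy by (intro realises_op[OF p[OF i] A, of _ k]) (auto simp: principal_mem)
      then show ?thesis using False unfolding pattern_compl by simp
    qed
    then have "map (\<lambda>s. trm_op A s (pattern n S x y)) (map p [1..<Suc n])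
        = pattern n S (trm_op A t [x, y]) (trm_op A t [y, x])"
      unfolding pattern_def by (simp del: upt_Suc)
    moreover have "trm_op A t [x, y] \<in> univ A" "trm_op A t [y, x] \<in> univ A"
      using trm_op_in[OF A nary(1)] xy by auto
    ultimately show "trm_op A (app s' (map p [1..<Suc n])) (pattern n S x y)
        = trm_op A (app t' [t, app t [Var 2, Var 1]]) [x, y]"
      using realises_op[OF s' A S]
      by (simp add: trm_op_app[OF s''(2)] op del: upt_Suc One_nat_def)
  qed
  then show "\<exists>s. realises n \<F> (app t' [t, app t [Var 2, Var 1]]) s" by blast
qed

text \<open>
  Let \<open>c = f(x, y)\<close> and \<open>k = f(c, x)\<close>, where \<open>x\<close> is the majority value.  Then \<open>U\<close> evaluates to
  \<open>c\<close>, and \<open>K\<close> evaluates to \<open>k\<close> if the \<open>i\<close>-th argument is \<open>x\<close> and to \<open>c\<close> otherwise.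
\<close>

lemma realises_twist3:
  "realises 3 majority3 (app f [f, app f [f, Var 1]])
     (let U = h 3 majority3;
        K = (\<lambda>i j k. app (h 3 (principal_family 3 1)) [U, app f [Var i, Var j], app f [Var i, Var k]])
      in app (h 4 majority4) [U, K 1 2 3, K 2 1 3, K 3 1 2])" (is "realises _ _ _ ?s")
proof (rule realisesI)
  have t: "clone_term 3 (h 3 majority3)" "clone_term 3 (h 3 (principal_family 3 1))" "clone_term 4 (h 4 majority4)"
    by (simp_all add: clone_term_h max_intersecting_majority3 max_intersecting_majority4
        max_intersecting_principal)
  show "clone_term 3 ?s"
    by (simp add: Let_def t clone_term_app[OF t(2)] clone_term_app[OF t(3)] clone_term_app[OF clone_term_f] clone_term_Var
        del: One_nat_def)
  have app: "nary V 3 (h 3 majority3)" "nary V 3 (h 3 (principal_family 3 1))" "nary V 4 (h 4 majority4)"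
    using t unfolding clone_term_def by auto
  fix A :: "'s talg" and x y S j
  assume A: "in_variety A V" and xy: "x \<in> univ A" "y \<in> univ A"
    and S: "S \<in> majority3" "j \<in> {1..3}" "j \<notin> S"
  have "S = {1, 2} \<or> S = {1, 3} \<or> S = {2, 3}"
    using S unfolding majority3_def atLeastAtMost_numeral by auto
  \<comment> \<open>The outer term receives \<open>c\<close>, then two entries \<open>k\<close> and
    one \<open>c\<close> in some order. The first argument breaks the tie, giving
    \<open>f(c, k)\<close>. Where \<open>K\<close> evaluates to \<open>c\<close>, this is
    \<open>f(c, f(y, x)) = c\<close>, by absorption.\<close>
  then show "trm_op A ?s (pattern 3 S x y) = trm_op A (app f [f, app f [f, Var 1]]) [x, y]"
    using xy
    by (elim disjE) (simp_all add: Let_def pattern_numeral trm_op_Var trm_op_app[OF nary_f]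
      trm_op_app[OF app(2)] trm_op_app[OF app(3)] h3_op[OF A] h4_op[OF A] f_in[OF A] f_idem[OF A]
      f_op_absorb[OF A] del: One_nat_def)
qed

text \<open>Here \<open>(K, L)\<close> evaluates to \<open>(k, c)\<close> if the first argument is \<open>x\<close> and to \<open>(c, k)\<close> otherwise.\<close>

lemma realises_twist4:
  "realises 4 majority4 (app f [f, app f [f, Var 1]])
     (let U = h 4 majority4;
        K = app (h 4 (principal_family 4 1)) [U, app f [Var 1, Var 2], app f [Var 1, Var 3], app f [Var 1, Var 4]];
        L = app f [U, app (h 3 majority3) [Var 2, Var 3, Var 4]]
      in app (h 3 majority3) [K, L, U])" (is "realises _ _ _ ?s")
proof (rule realisesI)
  have t: "clone_term 3 (h 3 majority3)" "clone_term 4 (h 4 (principal_family 4 1))" "clone_term 4 (h 4 majority4)"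
    by (simp_all add: clone_term_h max_intersecting_majority3 max_intersecting_majority4
        max_intersecting_principal)
  show "clone_term 4 ?s"
    by (simp add: Let_def t clone_term_app[OF t(1)] clone_term_app[OF t(2)] clone_term_app[OF clone_term_f] clone_term_Var
        del: One_nat_def)
  have app: "nary V 3 (h 3 majority3)" "nary V 4 (h 4 (principal_family 4 1))" "nary V 4 (h 4 majority4)"
    using t unfolding clone_term_def by auto
  fix A :: "'s talg" and x y S j
  assume A: "in_variety A V" and xy: "x \<in> univ A" "y \<in> univ A"
    and S: "S \<in> majority4" "j \<in> {1..4}" "j \<notin> S"
  have "S \<noteq> {1, 2, 3, 4}" using S(2,3) unfolding atLeastAtMost_numeral by blast
  then have "S = {1, 2} \<or> S = {1, 3} \<or> S = {1, 4} \<or> S = {1, 2, 3} \<or> S = {1, 2, 4} \<or>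
      S = {1, 3, 4} \<or> S = {2, 3, 4}"
    using S(1) unfolding majority4_def by (simp only: insert_iff empty_iff simp_thms)
  \<comment> \<open>Of \<open>K\<close>, \<open>L\<close>, \<open>U\<close> two evaluate to
    \<open>c\<close> and one to \<open>k\<close>, so the majority term gives
    \<open>f(c, k)\<close>.\<close>
  then show "trm_op A ?s (pattern 4 S x y) = trm_op A (app f [f, app f [f, Var 1]]) [x, y]"
    using xy
    by (elim disjE) (simp_all add: Let_def pattern_numeral trm_op_Var trm_op_app[OF nary_f]
      trm_op_app[OF app(1)] trm_op_app[OF app(2)] h3_op[OF A] h4_op[OF A] f_in[OF A] f_idem[OF A]
      f_op_absorb[OF A] del: One_nat_def)
qed

text \<open>Since \<open>i\<close> lies in \<open>S\<close>, the \<open>i\<close>-th argument is the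
  value \<open>x\<close>, and the term for \<open>twist\<close> can be copied with
  \<open>Var i\<close> in place of \<open>Var 1\<close>.\<close>

lemma realises_twist_principal:
  assumes "n \<in> {3, 4}" "i \<in> {1..n}"
  shows "realises n (principal_family n i) (app f [f, app f [f, Var 1]])
    (app f [h n (principal_family n i), app f [h n (principal_family n i), Var i]])" (is "realises _ _ _ ?s")
proof (rule realisesI)
  have n: "n \<ge> 2" "max_intersecting n (principal_family n i)"
    using assms max_intersecting_principal by auto
  then have t: "clone_term n (h n (principal_family n i))" by (rule clone_term_h)
  have "clone_term n (Var i)" using assms by (auto intro: clone_term_Var)
  then show "clone_term n ?s" by (simp add: clone_term_app[OF clone_term_f] t)
  fix A :: "'s talg" and x y S j
  assume A: "in_variety A V" and xy: "x \<in> univ A" "y \<in> univ A"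
    and S: "S \<in> principal_family n i" "j \<in> {1..n}" "j \<notin> S"
  have "trm_op A (h n (principal_family n i)) (pattern n S x y) = trm_op A f [x, y]"
    by (rule h_op[OF A n S(1) _ xy]) (use S in auto)
  moreover have "pattern n S x y ! (i - 1) = x"
    using S(1) assms unfolding principal_mem pattern_def by (auto simp del: upt_Suc)
  ultimately show "trm_op A ?s (pattern n S x y) = trm_op A (app f [f, app f [f, Var 1]]) [x, y]"
    by (simp add: trm_op_Var trm_op_app[OF nary_f])
qed

lemma symmetrisable_twist: "symmetrisable (app f [f, app f [f, Var 1]])"
proof -
  have "clone_term 2 (app f [f, app f [f, Var 1]])"
    by (simp add: clone_term_app[OF clone_term_f] clone_term_f clone_term_Var)
  then show ?thesis
    unfolding symmetrisable_def families_def
    using realises_twist3 realises_twist4 realises_twist_principal by blast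
qed

section \<open>From derived operations to edges, by minimality\<close>

lemma derived_symmetrisable:
  fixes A :: "'s talg"
  assumes A: "in_variety A V" and "derived (\<lambda>x y. trm_op A f [x, y]) w"
  shows "\<exists>t. symmetrisable t \<and> (\<forall>x y. w x y = trm_op A t [x, y])"
  using assms(2)
proof induction
  case base
  then show ?case using symmetrisable_base by blast
next
  case (join w w')
  then obtain t t' where "symmetrisable t" "\<forall>x y. w x y = trm_op A t [x, y]"
    "symmetrisable t'" "\<forall>x y. w' x y = trm_op A t' [x, y]" by blast
  then show ?case
    by (intro exI[of _ "app f [t, t']"]) (simp add: symmetrisable_join trm_op_app[OF nary_f])
next
  case twist
  show ?case
    using symmetrisable_twist
    by (intro exI[of _ "app f [f, app f [f, Var 1]]"]) (simp add: trm_op_Var trm_op_app[OF nary_f])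
next
  case (comp w w')
  then obtain t t' where t: "symmetrisable t" "\<forall>x y. w x y = trm_op A t [x, y]"
    "symmetrisable t'" "\<forall>x y. w' x y = trm_op A t' [x, y]" by blast
  then have nary: "nary V 2 t" "nary V 2 t'" unfolding symmetrisable_def clone_term_def by auto
  show ?case
    using t
    by (intro exI[of _ "app t' [t, app t [Var 2, Var 1]]"])
      (simp add: symmetrisable_comp trm_op_app[OF nary(1)] trm_op_app[OF nary(2)] trm_op_Var
        del: One_nat_def)
qed

lemma realises_veq:
  assumes "realises n \<F> t s" "nary V 2 t" "S \<in> \<F>" "j \<in> {1..n}" "j \<notin> S"
  shows "veq V (app s (pattern n S (Var 1) (Var 2))) (app t [Var 1, Var 2])"
  unfolding veq_def
proof (intro conjI allI impI)
  have s: "nary V n s" using assms(1) unfolding realises_def clone_term_def by blast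
  have "nary V 2 (app s (pattern n S (Var 1) (Var 2)))"
    by (rule nary_app[OF s]) (auto simp: pattern_def nary_Var simp del: upt_Suc)
  moreover have "nary V 2 (app t [Var 1, Var 2])"
    by (rule nary_app[OF assms(2)]) (auto simp: nary_Var)
  ultimately show "wf_trm V (app s (pattern n S (Var 1) (Var 2)))" "wf_trm V (app t [Var 1, Var 2])"
    unfolding nary_def by auto
  fix A :: "'s talg" assume A: "in_variety A V"
  show "holds A (app s (pattern n S (Var 1) (Var 2))) (app t [Var 1, Var 2])"
    unfolding holds_def
  proof (intro allI impI)
    fix v :: "nat \<Rightarrow> 's trm set" assume v: "range v \<subseteq> univ A"
    have "map (eval A v) (pattern n S (Var 1) (Var 2)) = pattern n S (v 1) (v 2)"
      by (auto simp: pattern_def simp del: upt_Suc)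
    then show "eval A v (app s (pattern n S (Var 1) (Var 2))) = eval A v (app t [Var 1, Var 2])"
      using realises_op[OF assms(1) A assms(3-5), of "v 1" "v 2"] v
      by (simp add: eval_app[OF s] eval_app[OF assms(2)] image_subset_iff)
  qed
qed

text \<open>\<open>s\<close> and \<open>s'\<close> serve as the terms \<open>g0\<close> and
  \<open>h0\<close>: the sets with exactly one position missing belong to the majority families, so
  all values in question equal \<open>t(x, y)\<close>.\<close>

lemma realises_bounded_width:
  assumes "nary V 2 t" "realises 3 majority3 t s" "realises 4 majority4 t s'" "s \<in> D" "s' \<in> D"
  shows "bounded_width V D"
proof -
  have 3: "veq V (app s (pattern 3 S (Var 1) (Var 2))) (app t [Var 1, Var 2])"
    if "S \<in> majority3" "j \<in> {1..3}" "j \<notin> S" for S j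
    by (rule realises_veq[OF assms(2,1) that])
  have 4: "veq V (app s' (pattern 4 S (Var 1) (Var 2))) (app t [Var 1, Var 2])"
    if "S \<in> majority4" "j \<in> {1..4}" "j \<notin> S" for S j
    by (rule realises_veq[OF assms(3,1) that])
  have "veq V (app s [Var 1, Var 1, Var 2]) (app t [Var 1, Var 2])"
    "veq V (app s [Var 1, Var 2, Var 1]) (app t [Var 1, Var 2])"
    "veq V (app s [Var 2, Var 1, Var 1]) (app t [Var 1, Var 2])"
    using 3[of "{1, 2}" 3] 3[of "{1, 3}" 2] 3[of "{2, 3}" 1]
    by (simp_all add: pattern_numeral majority3_mem del: One_nat_def)
  moreover have "veq V (app s' [Var 1, Var 1, Var 1, Var 2]) (app t [Var 1, Var 2])"
    "veq V (app s' [Var 1, Var 1, Var 2, Var 1]) (app t [Var 1, Var 2])"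
    "veq V (app s' [Var 1, Var 2, Var 1, Var 1]) (app t [Var 1, Var 2])"
    "veq V (app s' [Var 2, Var 1, Var 1, Var 1]) (app t [Var 1, Var 2])"
    using 4[of "{1, 2, 3}" 4] 4[of "{1, 2, 4}" 3] 4[of "{1, 3, 4}" 2] 4[of "{2, 3, 4}" 1]
    by (simp_all add: pattern_numeral majority4_mem del: One_nat_def)
  moreover have "nary V 3 s" "nary V 4 s'" using assms unfolding realises_def clone_term_def by auto
  ultimately show ?thesis
    unfolding bounded_width_def Let_def using assms(4,5) by (meson veq_sym veq_trans)
qed

text \<open>A constant list is handled by idempotence. Otherwise the positions of \<open>u\<close>
  or those of \<open>v\<close> form a member of the family, and the value is
  \<open>t(u, v) = u\<close> or \<open>t(v, u) = v\<close>.\<close>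

lemma realises_preserves:
  fixes A :: "'s talg"
  assumes F: "(n, \<F>) \<in> families" and s: "realises n \<F> t s"
    and A: "in_variety A V" "u \<in> univ A" "v \<in> univ A"
    and t: "trm_op A t [u, v] = u" "trm_op A t [v, u] = v"
    and as: "length as = n" "set as \<subseteq> {u, v}"
  shows "trm_op A s as \<in> {u, v}"
proof -
  define S where "S = {i \<in> {1..n}. as ! (i - 1) = u}"
  have as_eq: "as = pattern n S u v" unfolding S_def by (rule list_eq_pattern[OF as])
  have S: "S \<subseteq> {1..n}" unfolding S_def by blast
  have nary: "nary V n s" using s unfolding realises_def clone_term_def by blast
  consider "S = {1..n}" | "S = {}" | "S \<noteq> {}" "S \<noteq> {1..n}" "S \<in> \<F>"
    | "S \<noteq> {}" "S \<noteq> {1..n}" "{1..n} - S \<in> \<F>"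
    using max_intersecting_compl[OF families_max_intersecting(2)[OF F] S] by blast
  then show ?thesis
  proof cases
    case 1
    have "pattern n {1..n} u v = replicate n u"
      by (intro nth_equalityI) (auto simp: pattern_def simp del: upt_Suc)
    then show ?thesis using trm_op_idem[OF idempotent A(1) nary A(2)] as_eq 1 by simp
  next
    case 2
    have "pattern n {} u v = replicate n v"
      by (intro nth_equalityI) (auto simp: pattern_def simp del: upt_Suc)
    then show ?thesis using trm_op_idem[OF idempotent A(1) nary A(3)] as_eq 2 by simp
  next
    case 3
    then obtain j where "j \<in> {1..n}" "j \<notin> S" using S by blast
    then show ?thesis using realises_op[OF s A(1) 3(3) _ _ A(2,3), of j] as_eq t by simp
  next
    case 4
    then obtain j where "j \<in> {1..n}" "j \<notin> {1..n} - S" using S by blast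
    then show ?thesis
      using realises_op[OF s A(1) 4(3) _ _ A(3,2), of j] as_eq t pattern_compl[of n S v u] by simp
  qed
qed

lemma projection_closed_under:
  fixes A :: "'s talg"
  assumes t: "symmetrisable t" and A: "in_variety A V" "u \<in> univ A" "v \<in> univ A"
    and uv: "trm_op A t [u, v] = u" "trm_op A t [v, u] = v"
  shows "closed_under A 3 g {u, v}"
proof -
  \<comment> \<open>A subclone of bounded width, hence all of \<open>Clo V {g}\<close>.\<close>
  define D where "D = {s \<in> Clo V {g}. \<forall>w. range w \<subseteq> {u, v} \<longrightarrow> eval A w s \<in> {u, v}}"
  have in_D: "s \<in> D" if F: "(n, \<F>) \<in> families" and s: "realises n \<F> t s" for n \<F> s
  proof -
    have s': "s \<in> Clo V {g}" "nary V n s" using s unfolding realises_def clone_term_def by auto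
    moreover have "eval A w s \<in> {u, v}" if "range w \<subseteq> {u, v}" for w
      unfolding eval_eq_trm_op[OF s'(2)]
      by (rule realises_preserves[OF F s A uv]) (use that in \<open>auto simp del: upt_Suc\<close>)
    ultimately show ?thesis unfolding D_def by blast
  qed
  have F: "(3, majority3) \<in> families" "(4, majority4) \<in> families" unfolding families_def by auto
  obtain s where s: "realises 3 majority3 t s" using symmetrisable_realises[OF t F(1)] .
  obtain s' where s': "realises 4 majority4 t s'" using symmetrisable_realises[OF t F(2)] .
  have "nary V 2 t" using t unfolding symmetrisable_def clone_term_def by blast
  then have "bounded_width V D"
    using realises_bounded_width s s' in_D[OF F(1) s] in_D[OF F(2) s'] by blast
  moreover have "clone V D"
    unfolding D_def by (rule clone_preserving[OF clone_Clo_g A(1)]) (use A in auto)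
  moreover have "D \<subseteq> Clo V {g}" unfolding D_def by blast
  ultimately have "D = Clo V {g}" using minimal unfolding minimal_bounded_width_def by blast
  then have "g \<in> D" using Clo_base[of g "{g}" V] by simp
  then have g: "eval A w g \<in> {u, v}" if "range w \<subseteq> {u, v}" for w
    using that unfolding D_def by simp
  show ?thesis
    unfolding closed_under_def
  proof (intro allI impI)
    fix as assume as: "length as = 3 \<and> set as \<subseteq> {u, v}"
    have "\<exists>w. range w \<subseteq> {u, v} \<and> (\<forall>t. nary V 3 t \<longrightarrow> trm_op A t as = eval A w t)"
      by (rule trm_op_valuation) (use as in auto)
    then obtain w where "range w \<subseteq> {u, v} \<and> (\<forall>t. nary V 3 t \<longrightarrow> trm_op A t as = eval A w t)" ..
    then show "trm_op A g as \<in> {u, v}" using g[of w] nary_g by simp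
  qed
qed

section \<open>The edge axioms for pairs closed under \<open>g\<close>\<close>

lemma closed_under_pairI:
  fixes A :: "'s talg"
  assumes A: "in_variety A V" "u \<in> univ A" "v \<in> univ A"
    and uv: "trm_op A f [u, v] \<in> {u, v}" "trm_op A f [v, u] \<in> {u, v}"
  shows "closed_under A 3 g {u, v}"
  unfolding closed_under_def
proof (intro allI impI)
  fix as assume as: "length as = 3 \<and> set as \<subseteq> {u, v}"
  then obtain x y z where xyz: "as = [x, y, z]"
    by (auto simp: numeral_3_eq_3 length_Suc_conv)
  then have "x \<in> {u, v}" "y \<in> {u, v}" "z \<in> {u, v}" using as by auto
  \<comment> \<open>Two of three entries from \<open>{u, v}\<close> coincide, so \<open>g\<close>
    reduces to \<open>f\<close>.\<close>
  then show "trm_op A g as \<in> {u, v}"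
    using uv A(2,3) unfolding xyz by (elim insertE emptyE) (auto simp: g_op[OF A(1)] f_idem[OF A(1)])
qed

text \<open>For \<open>n = 2\<close> the principal family \<open>{{1}, {1, 2}}\<close> has
  \<open>f\<close> itself as its term, up to identities. This brings the binary terms built from
  \<open>f\<close> within the scope of \<open>semilattice\<close>.\<close>

lemma f_Clo_h: "f \<in> Clo V {h n \<F> | n \<F>. n \<ge> 2 \<and> max_intersecting n \<F>}" (is "_ \<in> Clo V ?H")
proof -
  let ?P = "principal_family 2 1"
  have P: "max_intersecting 2 ?P" by (rule max_intersecting_principal) simp
  have "veq V (app (h 2 ?P) (map Var [1..<Suc 2])) (app f [Var 1, Var 2])"
    by (rule h_symmetric[OF _ P]) (auto simp: principal_family_def atLeastAtMost_numeral)
  moreover have "map Var [1..<Suc 2] = [Var 1, Var 2 :: 's trm]" by (simp add: numeral_2_eq_2)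
  ultimately have "veq V (h 2 ?P) f"
    using app_Var[OF nary_h[OF _ P]] app_Var[OF nary_f] by simp
  moreover have "h 2 ?P \<in> Clo V ?H" using P by (intro Clo_base) blast
  moreover have "clone V (Clo V ?H)"
    by (rule clone_Clo) (use nary_h in \<open>auto simp: nary_def\<close>)
  ultimately show ?thesis unfolding clone_def by blast
qed

lemma gen_pair_term:
  fixes A :: "'s talg"
  assumes "p \<in> gen (pair_op (\<lambda>x y. trm_op A f [x, y])) {(x, y), (y, x)}" "clone V C" "f \<in> C"
  shows "\<exists>t\<in>C. nary V 2 t \<and> p = (trm_op A t [x, y], trm_op A t [y, x])"
  using assms(1)
proof induction
  case (base p)
  have "Var 1 \<in> C" "Var 2 \<in> C" using clone_Var[OF assms(2)] by auto
  moreover have "nary V 2 (Var 1)" "nary V 2 (Var 2)" by (simp_all add: nary_Var)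
  moreover have "p = (trm_op A (Var 1) [x, y], trm_op A (Var 1) [y, x]) \<or>
      p = (trm_op A (Var 2) [x, y], trm_op A (Var 2) [y, x])"
    using base by (auto simp: trm_op_Var)
  ultimately show ?case by blast
next
  case (step p q)
  then obtain s t where s: "s \<in> C" "nary V 2 s" "p = (trm_op A s [x, y], trm_op A s [y, x])"
    and t: "t \<in> C" "nary V 2 t" "q = (trm_op A t [x, y], trm_op A t [y, x])" by blast
  have "app f [s, t] \<in> C" by (rule clone_app[OF assms(2,3) nary_f]) (use s t in auto)
  moreover have "nary V 2 (app f [s, t])" by (rule nary_app[OF nary_f]) (use s t in auto)
  ultimately show ?case
    using s(3) t(3) by (intro bexI[of _ "app f [s, t]"]) (auto simp: trm_op_app[OF nary_f])
qed

lemma edge_groupoid_closed_under: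
  fixes A :: "'s talg"
  assumes A: "in_variety A V" and B: "finite B" "B \<subseteq> univ A" "closed (\<lambda>x y. trm_op A f [x, y]) B"
  shows "edge_groupoid B (\<lambda>x y. trm_op A f [x, y]) (\<lambda>x y. closed_under A 3 g {x, y})"
proof unfold_locales
  let ?F = "\<lambda>x y. trm_op A f [x, y]"
  fix x y
  show "closed_under A 3 g {x, y} \<Longrightarrow> closed_under A 3 g {y, x}" by (simp add: insert_commute)
  show "x \<in> B \<Longrightarrow> ?F x x = x" using f_idem[OF A] B(2) by blast
  assume x: "x \<in> B" and y: "y \<in> B"
  then have xy: "x \<in> univ A" "y \<in> univ A" using B(2) by auto
  show "?F x y \<in> {x, y}" if "closed_under A 3 g {x, y}"
  proof -
    have "trm_op A g [x, x, y] \<in> {x, y}" using that unfolding closed_under_def by auto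
    then show ?thesis using g_op[OF A xy] by simp
  qed
  \<comment> \<open>By absorption, \<open>f\<close> acts as the first projection on this
    pair.\<close>
  show "closed_under A 3 g {?F x y, ?F y x}"
    using f_op_absorb[OF A xy] f_op_absorb[OF A xy(2,1)]
    by (intro closed_under_pairI[OF A] f_in[OF A] xy) auto
  show "closed_under A 3 g {x, y}" if "derived ?F w" "w x y = x" "w y x = y" for w
    using derived_symmetrisable[OF A that(1)] that(2,3) projection_closed_under[OF _ A xy] by metis
  show "closed_under A 3 g {x, y}" if gen: "(y, y) \<in> gen (pair_op ?F) {(x, y), (y, x)}"
  proof (cases "x = y")
    case True
    then show ?thesis using closed_under_pairI[OF A xy] f_idem[OF A xy(1)] by simp
  next
    case False
    let ?H = "{h n \<F> | n \<F>. n \<ge> 2 \<and> max_intersecting n \<F>}"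
    have "clone V (Clo V ?H)" by (rule clone_Clo) (use nary_h in \<open>auto simp: nary_def\<close>)
    \<comment> \<open>The pair \<open>(y, y)\<close> comes from a term with
      \<open>t(x, y) = t(y, x) = y\<close>, and \<open>semilattice\<close> passes this on to
      \<open>f\<close>.\<close>
    then obtain t where "t \<in> Clo V ?H" "nary V 2 t" "trm_op A t [x, y] = y" "trm_op A t [y, x] = y"
      using gen_pair_term[OF gen _ f_Clo_h] by auto
    then have "?F y x = y \<and> ?F x y = y"
      using semilattice[OF _ _ A xy(2,1)] False by blast
    then show ?thesis by (intro closed_under_pairI[OF A xy]) auto
  qed
qed (rule B)+

end


section \<open>Connectivity of the free algebra\<close>

theorem theorem7:
  fixes V :: "'s variety" and f g :: "'s trm"
  assumes "is_variety V"
    and "locally_finite V"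
    and "idempotent_variety V"
    and "bounded_width_variety V"
    and "standard_pair V f g"
    and "minimal_bounded_width V (Clo V {g})"
  shows "\<exists>(n :: nat) (p :: nat \<Rightarrow> 's trm).
    (\<forall>i\<le>n. nary V 2 (p i) \<and> p i \<in> Clo V {f}) \<and>
    veq V (app (p 0) [Var 1, Var 2]) (Var 1) \<and>
    veq V (app (p n) [Var 1, Var 2]) (Var 2) \<and>
    (\<forall>i<n. closed_under (free_alg V 2) 3 g
       {trm_op (free_alg V 2) (p i) [free_gen V 2 1, free_gen V 2 2],
        trm_op (free_alg V 2) (p (Suc i)) [free_gen V 2 1, free_gen V 2 2]})"
proof -
  note pair = assms(5)[unfolded standard_pair_def idempotent_trm_def Let_def]
  \<comment> \<open>The locale fixes a family \<open>h\<close> that a standard pair only asserts to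
    exist.\<close>
  obtain h where "minimal_pair V f g h"
  proof -
    have "\<exists>h :: nat \<Rightarrow> nat set set \<Rightarrow> 's trm.
        (\<forall>n \<F>. n \<ge> 2 \<and> max_intersecting n \<F> \<longrightarrow>
           h n \<F> \<in> Clo V {g} \<and> (nary V n (h n \<F>) \<and> veq V (app (h n \<F>) (replicate n (Var 1))) (Var 1)) \<and>
           (\<forall>a. a ` {1..n} = {Var 1, Var 2} \<and> {i\<in>{1..n}. a i = Var 1} \<in> \<F> \<longrightarrow>
              veq V (app (h n \<F>) (map a [1..<Suc n])) (app f [Var 1, Var 2]))) \<and>
        veq V g (h 3 {{1, 2}, {1, 3}, {2, 3}, {1, 2, 3}}) \<and>
        (\<forall>t\<in>Clo V {h n \<F> | n \<F>. n \<ge> 2 \<and> max_intersecting n \<F>}. nary V 2 t \<longrightarrow>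
           (\<forall>A :: 's talg. in_variety A V \<longrightarrow>
             (\<forall>a\<in>univ A. \<forall>b\<in>univ A. a \<noteq> b \<and> trm_op A t [a, b] = a \<and> trm_op A t [b, a] = a \<longrightarrow>
                trm_op A f [a, b] = a \<and> trm_op A f [b, a] = a)))" (is "\<exists>h. ?P h")
      using pair by (elim conjE)
    then obtain h where h: "?P h" ..
    note h1 = h[THEN conjunct1, rule_format, OF conjI]
    have "minimal_pair V f g h"
    proof
      show "idempotent_variety V" "minimal_bounded_width V (Clo V {g})" by fact+
      show "nary V 2 f" "nary V 3 g"
        "veq V (app g [Var 1, Var 1, Var 2]) (app f [Var 1, Var 2])"
        "veq V (app g [Var 1, Var 2, Var 1]) (app f [Var 1, Var 2])"
        "veq V (app g [Var 2, Var 1, Var 1]) (app f [Var 1, Var 2])"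
        "veq V (app f [app f [Var 1, Var 2], app f [Var 2, Var 1]]) (app f [Var 1, Var 2])"
        by (simp_all only: pair)
      fix n :: nat and \<F> assume F: "n \<ge> 2" "max_intersecting n \<F>"
      show "h n \<F> \<in> Clo V {g}" "nary V n (h n \<F>)" using h1[OF F] by simp_all
      show "veq V (app (h n \<F>) (map a [1..<Suc n])) (app f [Var 1, Var 2])"
        if "a ` {1..n} = {Var 1, Var 2}" "{i\<in>{1..n}. a i = Var 1} \<in> \<F>" for a
        using h1[OF F, THEN conjunct2, THEN conjunct2] that by simp
    next
      fix t c d and A :: "'s talg"
      assume "t \<in> Clo V {h n \<F> | n \<F>. n \<ge> 2 \<and> max_intersecting n \<F>}" "nary V 2 t"
        "in_variety A V" "c \<in> univ A" "d \<in> univ A" "c \<noteq> d"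
        "trm_op A t [c, d] = c" "trm_op A t [d, c] = c"
      then show "trm_op A f [c, d] = c \<and> trm_op A f [d, c] = c"
        using h[THEN conjunct2, THEN conjunct2, THEN bspec, THEN mp, THEN spec, THEN mp, THEN bspec,
            THEN bspec, THEN mp] by simp
    qed
    then show ?thesis by (rule that)
  qed
  then interpret minimal_pair V f g h .
  \<comment> \<open>Connectivity is applied to the classes of binary terms in
    \<open>Clo V {f}\<close> rather than to the whole free algebra, so that all vertices of the path
    are given by such terms.\<close>
  let ?A = "free_alg V 2" and ?B = "trm_class V 2 ` {t \<in> Clo V {f}. nary V 2 t}"
  have A: "in_variety ?A V" using free_alg_in_variety[OF assms(1)] by simp
  have op: "trm_op ?A t [free_gen V 2 1, free_gen V 2 2] = trm_class V 2 t" if "nary V 2 t" for t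
    using free_alg_trm_op[OF that] by (simp add: numeral_2_eq_2)
  have clone_f: "clone V (Clo V {f})" by (rule clone_Clo) (use nary_f in \<open>simp add: nary_def\<close>)
  have B: "?B \<subseteq> univ ?A" unfolding free_alg_univ by blast
  have closed: "closed (\<lambda>x y. trm_op ?A f [x, y]) ?B"
    unfolding closed_def
  proof (clarify)
    fix s t assume st: "s \<in> Clo V {f}" "nary V 2 s" "t \<in> Clo V {f}" "nary V 2 t"
    have n: "nary V 2 (app f [s, t])" by (rule nary_app[OF nary_f]) (use st in auto)
    have "app f [s, t] \<in> Clo V {f}"
      by (rule clone_app[OF clone_f _ nary_f]) (use st in \<open>auto intro: Clo_base\<close>)
    moreover have "trm_op ?A f [trm_class V 2 s, trm_class V 2 t] = trm_class V 2 (app f [s, t])"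
      using op[OF n] st by (simp add: trm_op_app[OF nary_f] op del: One_nat_def)
    ultimately show "trm_op ?A f [trm_class V 2 s, trm_class V 2 t] \<in> ?B" using n by blast
  qed
  have "finite ?B" by (rule finite_subset[OF B finite_free_alg[OF assms(1,2)]]) simp
  note edges = edge_groupoid_closed_under[OF A this B closed]
  define R where "R = {(x, y). x \<in> ?B \<and> y \<in> ?B \<and> closed_under ?A 3 g {x, y}}"
  have Var: "trm_class V 2 (Var i) \<in> ?B" "nary V 2 (Var i)" if "i \<in> {1, 2}" for i
    using that nary_Var[of i 2 V] clone_Var[OF clone_f] by auto
  have "(trm_class V 2 (Var 1), trm_class V 2 (Var 2)) \<in> R\<^sup>*"
    unfolding R_def by (rule edge_groupoid_connected[OF edges]) (use Var in auto)
  then obtain n where "(trm_class V 2 (Var 1), trm_class V 2 (Var 2)) \<in> R ^^ n"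
    using rtrancl_imp_relpow by blast
  then obtain c where c: "c 0 = trm_class V 2 (Var 1)" "c n = trm_class V 2 (Var 2)"
    "\<And>i. i < n \<Longrightarrow> (c i, c (Suc i)) \<in> R"
    unfolding relpow_fun_conv by blast
  \<comment> \<open>Every vertex but the last is the source of a step in \<open>R\<close>; the last
    one is the class of a variable.\<close>
  have "c i \<in> ?B" if "i \<le> n" for i
  proof (cases "i = n")
    case True
    then show ?thesis using c(2) Var by auto
  next
    case False
    then show ?thesis using c(3)[of i] that unfolding R_def by auto
  qed
  then have "\<forall>i. \<exists>t. i \<le> n \<longrightarrow> t \<in> Clo V {f} \<and> nary V 2 t \<and> c i = trm_class V 2 t" by blast
  then obtain p where p: "\<And>i. i \<le> n \<Longrightarrow> p i \<in> Clo V {f} \<and> nary V 2 (p i) \<and> c i = trm_class V 2 (p i)"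
    by metis
  have end_veq: "veq V (app (p i) [Var 1, Var 2]) (Var j)"
    if "i \<le> n" "c i = trm_class V 2 (Var j)" "j \<in> {1, 2}" for i j
    using p[OF that(1)] that(2) trm_class_eq_iff[of V 2 "p i" "Var j"] Var(2)[OF that(3)]
    by (simp add: app_Var[of V] del: One_nat_def)
  show ?thesis
  proof (intro exI conjI allI impI)
    show "veq V (app (p 0) [Var 1, Var 2]) (Var 1)" "veq V (app (p n) [Var 1, Var 2]) (Var 2)"
      by (rule end_veq; use c in simp)+
    fix i
    show "i \<le> n \<Longrightarrow> nary V 2 (p i)" "i \<le> n \<Longrightarrow> p i \<in> Clo V {f}" using p by auto
    assume i: "i < n"
    have "closed_under ?A 3 g {c i, c (Suc i)}" using c(3)[OF i] unfolding R_def by simp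
    then show "closed_under ?A 3 g
       {trm_op ?A (p i) [free_gen V 2 1, free_gen V 2 2],
        trm_op ?A (p (Suc i)) [free_gen V 2 1, free_gen V 2 2]}"
      using p[of i] p[of "Suc i"] i by (simp add: op del: One_nat_def)
  qed
qed

end
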